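(* For $n\geqslant4$, the monoids $\mathcal{ODI}_n$, $\mathcal{MDI}_n$ and $\mathcal{OPDI}_n$ have ranks (as monoids) $$n+2\left\lfloor\tfrac{n-1}{2}\right\rfloor,\qquad 2+3\left\lfloor\tfrac{n-1}{2}\right\rfloor\qquad\text{and}\qquad 2+\left\lfloor\tfrac{n-1}{2}\right\rfloor,$$ respectively.
   Context: Let $\Omega_n=\{1<2<\cdots<n\}$. A partial transformation of $\Omega_n$ is a map $\alpha$ from a subset $\mathrm{Dom}(\alpha)\subseteq\Omega_n$ (possibly empty) to $\Omega_n$; maps are written on the right and composed left to right: $x(\alpha\beta)=(x\alpha)\beta$ with $\mathrm{Dom}(\alpha\beta)=\{x\in\mathrm{Dom}(\alpha)\mid x\alpha\in\mathrm{Dom}(\beta)\}$. The cycle graph $C_n$ has vertex set $\Omega_n$ and edges $\{i,i+1\}$ ($1\leqslant i\leqslant n-1$) and $\{1,n\}$; its geodesic distance is $\mathrm{d}(x,y)=\min\{|x-y|,n-|x-y|\}$. A partial isometry of $C_n$ is a partial transformation $\alpha$ of $\Omega_n$ with $\mathrm{d}(x\alpha,y\alpha)=\mathrm{d}(x,y)$ for all $x,y\in\mathrm{Dom}(\alpha)$ (such $\alpha$ is necessarily injective). $\mathcal{DI}_n$ is the monoid of all partial isometries of $C_n$ under composition. A partial transformation $\alpha$ is order-preserving [order-reversing] if $x\leqslant y$ implies $x\alpha\leqslant y\alpha$ [$x\alpha\geqslant y\alpha$] for all $x,y\in\mathrm{Dom}(\alpha)$; it is monotone if it is order-preserving or order-reversing.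 A sequence $(a_1,\ldots,a_t)$ ($t\geqslant 0$) of elements of $\Omega_n$ is cyclic if there is at most one index $i\in\{1,\ldots,t\}$ with $a_i>a_{i+1}$, where $a_{t+1}=a_1$. A partial transformation $\alpha$ with $\mathrm{Dom}(\alpha)=\{a_1<\cdots<a_t\}$ is orientation-preserving if $(a_1\alpha,\ldots,a_t\alpha)$ is cyclic. $\mathcal{ODI}_n$, $\mathcal{MDI}_n$, $\mathcal{OPDI}_n$ are the submonoids of $\mathcal{DI}_n$ of all order-preserving, monotone, and orientation-preserving elements, respectively. The rank of a monoid $M$ is the minimum size of a subset $X\subseteq M$ that generates $M$ as a monoid (the identity is obtained as the empty product). *)

theory Defs
  imports "HOL-Algebra.Group"
begin

section \<open>Generating sets and rank of a monoid\<close>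

inductive_set monoid_generate :: "('a, 'b) monoid_scheme \<Rightarrow> 'a set \<Rightarrow> 'a set"
  for M (structure) and X where
  one: "\<one> \<in> monoid_generate M X"
| mult: "x \<in> X \<Longrightarrow> y \<in> monoid_generate M X \<Longrightarrow> x \<otimes> y \<in> monoid_generate M X"

text \<open>The rank is only meaningful for finitely generated monoids, in particular for finite
  ones; see \<open>monoid_rank_attained\<close> below.\<close>

definition monoid_rank :: "('a, 'b) monoid_scheme \<Rightarrow> nat" where
  "monoid_rank M =
     (LEAST k. \<exists>X. X \<subseteq> carrier M \<and> finite X \<and> card X = k \<and> monoid_generate M X = carrier M)"

section \<open>Partial transformations of the chain \<open>1 < 2 < \<dots> < n\<close>\<close>

text \<open>Maps act on the right: the product of \<open>\<alpha>\<close> and \<open>\<beta>\<close> is \<open>\<alpha>\<close> followed by \<open>\<beta>\<close>.\<close>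

definition PT :: "nat \<Rightarrow> (nat \<rightharpoonup> nat) monoid" where
  "PT n = \<lparr>carrier = {\<alpha>. dom \<alpha> \<subseteq> {1..n} \<and> ran \<alpha> \<subseteq> {1..n}},
           monoid.mult = (\<lambda>\<alpha> \<beta>. \<beta> \<circ>\<^sub>m \<alpha>),
           one = Some |` {1..n}\<rparr>"

definition order_preserving :: "(nat \<rightharpoonup> nat) \<Rightarrow> bool" where
  "order_preserving \<alpha> \<longleftrightarrow> (\<forall>x\<in>dom \<alpha>. \<forall>y\<in>dom \<alpha>. x \<le> y \<longrightarrow> the (\<alpha> x) \<le> the (\<alpha> y))"

definition order_reversing :: "(nat \<rightharpoonup> nat) \<Rightarrow> bool" where
  "order_reversing \<alpha> \<longleftrightarrow> (\<forall>x\<in>dom \<alpha>. \<forall>y\<in>dom \<alpha>. x \<le> y \<longrightarrow> the (\<alpha> x) \<ge> the (\<alpha> y))"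

definition monotone_ptrans :: "(nat \<rightharpoonup> nat) \<Rightarrow> bool" where
  "monotone_ptrans \<alpha> \<longleftrightarrow> order_preserving \<alpha> \<or> order_reversing \<alpha>"

text \<open>Lists are indexed from 0, so the cyclic successor of index \<open>i\<close> is
  \<open>Suc i mod length xs\<close>.\<close>

definition cyclic_seq :: "nat list \<Rightarrow> bool" where
  "cyclic_seq xs \<longleftrightarrow> (\<exists>\<^sub>\<le>\<^sub>1 i. i < length xs \<and> xs ! i > xs ! (Suc i mod length xs))"

definition orientation_preserving :: "(nat \<rightharpoonup> nat) \<Rightarrow> bool" where
  "orientation_preserving \<alpha> \<longleftrightarrow>
     cyclic_seq (map (\<lambda>x. the (\<alpha> x)) (sorted_list_of_set (dom \<alpha>)))"

section \<open>Partial isometries of the cycle graph\<close>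

text \<open>The geodesic distance of the cycle graph with vertex set \<open>{1..n}\<close>.\<close>

definition cycle_dist :: "nat \<Rightarrow> nat \<Rightarrow> nat \<Rightarrow> int" where
  "cycle_dist n x y = min \<bar>int x - int y\<bar> (int n - \<bar>int x - int y\<bar>)"

definition DI :: "nat \<Rightarrow> (nat \<rightharpoonup> nat) monoid" where
  "DI n = PT n\<lparr>carrier := {\<alpha> \<in> carrier (PT n). \<forall>x\<in>dom \<alpha>. \<forall>y\<in>dom \<alpha>.
                 cycle_dist n (the (\<alpha> x)) (the (\<alpha> y)) = cycle_dist n x y}\<rparr>"

definition ODI :: "nat \<Rightarrow> (nat \<rightharpoonup> nat) monoid" where
  "ODI n = DI n\<lparr>carrier := {\<alpha> \<in> carrier (DI n). order_preserving \<alpha>}\<rparr>"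

definition MDI :: "nat \<Rightarrow> (nat \<rightharpoonup> nat) monoid" where
  "MDI n = DI n\<lparr>carrier := {\<alpha> \<in> carrier (DI n). monotone_ptrans \<alpha>}\<rparr>"

definition OPDI :: "nat \<Rightarrow> (nat \<rightharpoonup> nat) monoid" where
  "OPDI n = DI n\<lparr>carrier := {\<alpha> \<in> carrier (DI n). orientation_preserving \<alpha>}\<rparr>"

section \<open>These are finite monoids, and their ranks are attained\<close>

lemma monoid_generate_subset:
  assumes "monoid M" "X \<subseteq> carrier M"
  shows "monoid_generate M X \<subseteq> carrier M"
proof
  interpret monoid M by fact
  fix x assume "x \<in> monoid_generate M X"
  then show "x \<in> carrier M" by induction (use assms(2) in auto)
qed

lemma monoid_rank_attained:
  assumes "monoid M" "finite (carrier M)"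
  shows "\<exists>X. X \<subseteq> carrier M \<and> finite X \<and> card X = monoid_rank M
             \<and> monoid_generate M X = carrier M"
proof -
  interpret monoid M by fact
  have "x \<in> monoid_generate M (carrier M)" if "x \<in> carrier M" for x
  proof -
    have "x \<otimes>\<^bsub>M\<^esub> \<one>\<^bsub>M\<^esub> \<in> monoid_generate M (carrier M)"
      using that by (intro monoid_generate.mult monoid_generate.one)
    then show ?thesis using r_one[OF that] by simp
  qed
  then have "monoid_generate M (carrier M) = carrier M"
    using monoid_generate_subset[OF assms(1)] by blast
  then have "\<exists>X. X \<subseteq> carrier M \<and> finite X \<and> card X = card (carrier M)
             \<and> monoid_generate M X = carrier M"
    using assms(2) by blast
  then show ?thesis unfolding monoid_rank_def by (rule LeastI)
qed

lemma monoid_PT: "monoid (PT n)"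
proof (rule monoidI)
  fix \<alpha> \<beta> assume "\<alpha> \<in> carrier (PT n)" "\<beta> \<in> carrier (PT n)"
  then show "\<alpha> \<otimes>\<^bsub>PT n\<^esub> \<beta> \<in> carrier (PT n)"
    by (fastforce simp: PT_def map_comp_def dom_def ran_def split: option.splits)
next
  show "\<one>\<^bsub>PT n\<^esub> \<in> carrier (PT n)"
    by (auto simp: PT_def ran_def restrict_map_def split: if_splits)
next
  fix \<alpha> \<beta> \<gamma>
  show "(\<alpha> \<otimes>\<^bsub>PT n\<^esub> \<beta>) \<otimes>\<^bsub>PT n\<^esub> \<gamma> = \<alpha> \<otimes>\<^bsub>PT n\<^esub> (\<beta> \<otimes>\<^bsub>PT n\<^esub> \<gamma>)"
    by (auto simp: PT_def map_comp_def fun_eq_iff split: option.splits)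
next
  fix \<alpha> assume a: "\<alpha> \<in> carrier (PT n)"
  have a': "x \<in> {1..n} \<and> y \<in> {1..n}" if "\<alpha> x = Some y" for x y
    using a that by (auto simp: PT_def intro: ranI)
  show "\<one>\<^bsub>PT n\<^esub> \<otimes>\<^bsub>PT n\<^esub> \<alpha> = \<alpha>"
  proof
    fix x
    show "(\<one>\<^bsub>PT n\<^esub> \<otimes>\<^bsub>PT n\<^esub> \<alpha>) x = \<alpha> x"
      using a'[of x] by (cases "\<alpha> x") (auto simp: PT_def map_comp_def restrict_map_def)
  qed
  show "\<alpha> \<otimes>\<^bsub>PT n\<^esub> \<one>\<^bsub>PT n\<^esub> = \<alpha>"
  proof
    fix x
    show "(\<alpha> \<otimes>\<^bsub>PT n\<^esub> \<one>\<^bsub>PT n\<^esub>) x = \<alpha> x"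
      using a'[of x] by (cases "\<alpha> x") (auto simp: PT_def map_comp_def restrict_map_def)
  qed
qed

lemma finite_carrier_PT: "finite (carrier (PT n))"
proof -
  have "carrier (PT n) \<subseteq> (\<Union>A\<in>Pow {1..n}. {\<alpha>. dom \<alpha> = A \<and> ran \<alpha> \<subseteq> {1..n}})"
    by (auto simp: PT_def)
  moreover have "finite (\<Union>A\<in>Pow {1..n}. {\<alpha>. dom \<alpha> = A \<and> ran \<alpha> \<subseteq> {1..n}})"
    by (intro finite_UN_I finite_set_of_finite_maps) (auto intro: finite_subset)
  ultimately show ?thesis by (rule finite_subset)
qed

lemma dom_mult_PT: "x \<in> dom (\<alpha> \<otimes>\<^bsub>PT n\<^esub> \<beta>) \<longleftrightarrow> x \<in> dom \<alpha> \<and> the (\<alpha> x) \<in> dom \<beta>"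
  by (auto simp: PT_def map_comp_def dom_def split: option.splits)

lemma the_mult_PT:
  "x \<in> dom (\<alpha> \<otimes>\<^bsub>PT n\<^esub> \<beta>) \<Longrightarrow> the ((\<alpha> \<otimes>\<^bsub>PT n\<^esub> \<beta>) x) = the (\<beta> (the (\<alpha> x)))"
  by (auto simp: PT_def map_comp_def dom_def split: option.splits)

lemma dom_one_PT: "dom \<one>\<^bsub>PT n\<^esub> = {1..n}"
  by (auto simp: PT_def restrict_map_def dom_def split: if_splits)

lemma the_one_PT: "x \<in> {1..n} \<Longrightarrow> the (\<one>\<^bsub>PT n\<^esub> x) = x"
  by (auto simp: PT_def restrict_map_def)

lemma submonoid_DI: "submonoid (carrier (DI n)) (PT n)"
proof -
  interpret monoid "PT n" by (rule monoid_PT)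
  show ?thesis
    by (rule submonoid.intro)
      (auto simp: DI_def dom_mult_PT the_mult_PT dom_one_PT the_one_PT)
qed

lemma DI_eq: "PT n\<lparr>carrier := carrier (DI n)\<rparr> = DI n"
  by (simp add: DI_def)

lemma monoid_DI: "monoid (DI n)"
  using submonoid.submonoid_is_monoid[OF submonoid_DI monoid_PT] by (simp add: DI_eq)

lemma mult_DI [simp]: "mult (DI n) = mult (PT n)" and one_DI [simp]: "one (DI n) = one (PT n)"
  by (simp_all add: DI_def)

lemma submonoid_ODI: "submonoid (carrier (ODI n)) (DI n)"
proof -
  interpret monoid "DI n" by (rule monoid_DI)
  have "order_preserving \<one>\<^bsub>PT n\<^esub>"
    by (simp add: order_preserving_def dom_one_PT the_one_PT)
  moreover have "order_preserving (\<alpha> \<otimes>\<^bsub>PT n\<^esub> \<beta>)"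
    if "order_preserving \<alpha>" "order_preserving \<beta>" for \<alpha> \<beta>
    using that by (simp add: order_preserving_def dom_mult_PT the_mult_PT)
  ultimately show ?thesis
    using m_closed one_closed by unfold_locales (auto simp: ODI_def)
qed

lemma submonoid_MDI: "submonoid (carrier (MDI n)) (DI n)"
proof -
  interpret monoid "DI n" by (rule monoid_DI)
  have "monotone_ptrans \<one>\<^bsub>PT n\<^esub>"
    by (simp add: monotone_ptrans_def order_preserving_def dom_one_PT the_one_PT)
  moreover have "monotone_ptrans (\<alpha> \<otimes>\<^bsub>PT n\<^esub> \<beta>)"
    if "monotone_ptrans \<alpha>" "monotone_ptrans \<beta>" for \<alpha> \<beta>
    using that unfolding monotone_ptrans_def
    by (elim disjE; simp add: order_preserving_def order_reversing_def dom_mult_PT the_mult_PT)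
  ultimately show ?thesis
    using m_closed one_closed by unfold_locales (auto simp: MDI_def)
qed

lemma inj_on_DI:
  assumes "\<alpha> \<in> carrier (DI n)"
  shows "inj_on (\<lambda>x. the (\<alpha> x)) (dom \<alpha>)"
proof (rule inj_onI)
  fix x y assume xy: "x \<in> dom \<alpha>" "y \<in> dom \<alpha>" "the (\<alpha> x) = the (\<alpha> y)"
  have "cycle_dist n (the (\<alpha> x)) (the (\<alpha> y)) = cycle_dist n x y"
    using assms xy(1,2) unfolding DI_def by simp
  moreover have "x \<in> {1..n}" "y \<in> {1..n}" using xy assms by (auto simp: DI_def PT_def)
  ultimately show "x = y" using xy(3) by (auto simp: cycle_dist_def min_def split: if_splits)
qed

text \<open>For maps that are injective, orientation preservation can be tested on triples, which makes
  closure under composition evident.\<close>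

definition cyc3 :: "nat \<Rightarrow> nat \<Rightarrow> nat \<Rightarrow> bool" where
  "cyc3 a b c \<longleftrightarrow> (a < b \<and> b < c) \<or> (b < c \<and> c < a) \<or> (c < a \<and> a < b)"

lemma ex_descent:
  fixes xs :: "nat list"
  assumes "i \<le> j" "xs ! i > xs ! j"
  shows "\<exists>m. i \<le> m \<and> m < j \<and> xs ! m > xs ! Suc m"
  using assms
proof (induction j rule: dec_induct)
  case base
  then show ?case by simp
next
  case (step j)
  show ?case
  proof (cases "xs ! i > xs ! j")
    case True
    then show ?thesis using step by (meson less_Suc_eq)
  next
    case False
    then show ?thesis using step by (intro exI[of _ j]) auto
  qed
qed

lemma ex_descent_wrap:
  fixes xs :: "nat list"
  assumes "i < k" "k < length xs" "xs ! k > xs ! i"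
  shows "\<exists>m < length xs. (m < i \<or> k \<le> m) \<and> xs ! m > xs ! (Suc m mod length xs)"
proof (rule ccontr)
  assume neg: "\<not> ?thesis"
  let ?l = "length xs - 1"
  have "\<not> xs ! k > xs ! ?l"
  proof
    assume "xs ! k > xs ! ?l"
    moreover have "k \<le> ?l" using assms by simp
    ultimately obtain m where "k \<le> m" "m < ?l" "xs ! m > xs ! Suc m"
      using ex_descent by blast
    then show False using neg by (auto dest!: spec[of _ m])
  qed
  moreover have "\<not> xs ! ?l > xs ! 0"
  proof -
    have "Suc ?l = length xs" using assms by simp
    then have "Suc ?l mod length xs = 0" "?l < length xs" "k \<le> ?l" using assms by simp_all
    then show ?thesis using neg by metis
  qed
  moreover have "\<not> xs ! 0 > xs ! i"
  proof
    assume "xs ! 0 > xs ! i"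
    then obtain m where "m < i" "xs ! m > xs ! Suc m"
      using ex_descent[of 0 i xs] by auto
    then show False using neg assms by (auto dest!: spec[of _ m])
  qed
  ultimately show False using assms by simp
qed

lemma cyclic_seq_iff_cyc3:
  assumes "distinct xs"
  shows "cyclic_seq xs \<longleftrightarrow>
    (\<forall>i j k. i < j \<and> j < k \<and> k < length xs \<longrightarrow> cyc3 (xs ! i) (xs ! j) (xs ! k))"
    (is "_ \<longleftrightarrow> ?R")
proof
  assume c: "cyclic_seq xs"
  have uniq: "p = q" if "p < length xs" "xs ! p > xs ! (Suc p mod length xs)"
    "q < length xs" "xs ! q > xs ! (Suc q mod length xs)" for p q
    using c that unfolding cyclic_seq_def Uniq_def by blast
  have D: "\<exists>m. i \<le> m \<and> m < j \<and> m < length xs \<and> xs ! m > xs ! (Suc m mod length xs)"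
    if "i < j" "j < length xs" "xs ! i > xs ! j" for i j
  proof -
    obtain m where m: "i \<le> m" "m < j" "xs ! m > xs ! Suc m"
      using ex_descent[of i j xs] \<open>i < j\<close> \<open>xs ! i > xs ! j\<close> by auto
    moreover have "Suc m mod length xs = Suc m" using m that by simp
    ultimately show ?thesis using that by (intro exI[of _ m]) simp
  qed
  show ?R
  proof (intro allI impI, rule ccontr)
    fix i j k assume ijk: "i < j \<and> j < k \<and> k < length xs"
      and n: "\<not> cyc3 (xs ! i) (xs ! j) (xs ! k)"
    have ne: "xs ! i \<noteq> xs ! j" "xs ! j \<noteq> xs ! k" "xs ! i \<noteq> xs ! k"
      using ijk assms by (auto simp: nth_eq_iff_index_eq)
    then consider "xs ! i > xs ! j" "xs ! j > xs ! k" | "xs ! i > xs ! j" "xs ! k > xs ! i"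
      | "xs ! j > xs ! k" "xs ! k > xs ! i"
      using n unfolding cyc3_def by linarith
    then show False
    proof cases
      case 1
      obtain p where "p < j" "p < length xs" "xs ! p > xs ! (Suc p mod length xs)"
        using D[of i j] 1 ijk by auto
      moreover obtain q where "j \<le> q" "q < length xs" "xs ! q > xs ! (Suc q mod length xs)"
        using D[of j k] 1 ijk by auto
      ultimately show False using uniq[of p q] by simp
    next
      case 2
      obtain p where "i \<le> p" "p < j" "p < length xs" "xs ! p > xs ! (Suc p mod length xs)"
        using D[of i j] 2 ijk by auto
      moreover obtain q where "q < i \<or> k \<le> q" "q < length xs"
        "xs ! q > xs ! (Suc q mod length xs)"
        using ex_descent_wrap[of i k xs] 2 ijk by auto
      ultimately show False using uniq[of p q] ijk by auto
    next
      case 3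
      obtain p where "j \<le> p" "p < k" "p < length xs" "xs ! p > xs ! (Suc p mod length xs)"
        using D[of j k] 3 ijk by auto
      moreover obtain q where "q < i \<or> k \<le> q" "q < length xs"
        "xs ! q > xs ! (Suc q mod length xs)"
        using ex_descent_wrap[of i k xs] 3 ijk by auto
      ultimately show False using uniq[of p q] ijk by auto
    qed
  qed
next
  assume R: ?R
  have False if pq: "p < q" "q < length xs" "xs ! p > xs ! (Suc p mod length xs)"
    "xs ! q > xs ! (Suc q mod length xs)" for p q
  proof -
    have p: "xs ! p > xs ! Suc p" using pq by simp
    have qp: "xs ! q < xs ! p"
    proof (cases "Suc p = q")
      case False
      then have "cyc3 (xs ! p) (xs ! Suc p) (xs ! q)" using R pq by simp
      then show ?thesis using p unfolding cyc3_def by linarith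
    qed (use p in simp)
    show False
    proof (cases "Suc q = length xs")
      case True
      then have q: "xs ! q > xs ! 0" using pq by simp
      show False
      proof (cases "p = 0")
        case False
        then have "cyc3 (xs ! 0) (xs ! p) (xs ! q)" using R pq by simp
        then show False using q qp unfolding cyc3_def by linarith
      qed (use q qp in simp)
    next
      case False
      then have "xs ! q > xs ! Suc q" "cyc3 (xs ! p) (xs ! q) (xs ! Suc q)" using R pq by simp_all
      then show False using qp unfolding cyc3_def by linarith
    qed
  qed
  then show "cyclic_seq xs"
    unfolding cyclic_seq_def Uniq_def by (metis nat_neq_iff)
qed

lemma orientation_preserving_iff_cyc3:
  assumes fin: "finite (dom \<alpha>)" and inj: "inj_on (\<lambda>x. the (\<alpha> x)) (dom \<alpha>)"
  shows "orientation_preserving \<alpha> \<longleftrightarrow>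
    (\<forall>x\<in>dom \<alpha>. \<forall>y\<in>dom \<alpha>. \<forall>z\<in>dom \<alpha>.
       cyc3 x y z \<longrightarrow> cyc3 (the (\<alpha> x)) (the (\<alpha> y)) (the (\<alpha> z)))"
    (is "_ \<longleftrightarrow> ?R")
proof -
  define s where "s = sorted_list_of_set (dom \<alpha>)"
  have s: "set s = dom \<alpha>" "sorted_wrt (<) s" "distinct s"
    using fin by (simp_all add: s_def)
  have "distinct (map (\<lambda>x. the (\<alpha> x)) s)" using s inj by (simp add: distinct_map)
  then have "orientation_preserving \<alpha> \<longleftrightarrow> (\<forall>i j k. i < j \<and> j < k \<and> k < length s \<longrightarrow>
      cyc3 (the (\<alpha> (s ! i))) (the (\<alpha> (s ! j))) (the (\<alpha> (s ! k))))"
    unfolding orientation_preserving_def s_def[symmetric] by (subst cyclic_seq_iff_cyc3) auto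
  also have "\<dots> \<longleftrightarrow> (\<forall>x\<in>dom \<alpha>. \<forall>y\<in>dom \<alpha>. \<forall>z\<in>dom \<alpha>.
       x < y \<and> y < z \<longrightarrow> cyc3 (the (\<alpha> x)) (the (\<alpha> y)) (the (\<alpha> z)))" (is "?A \<longleftrightarrow> ?B")
  proof
    assume A: ?A
    show ?B
    proof (intro ballI impI)
      fix x y z assume "x \<in> dom \<alpha>" "y \<in> dom \<alpha>" "z \<in> dom \<alpha>" and l: "x < y \<and> y < z"
      then obtain i j k where *: "x = s ! i" "y = s ! j" "z = s ! k"
        "i < length s" "j < length s" "k < length s"
        unfolding s(1)[symmetric] by (metis in_set_conv_nth)
      then have "i < j" "j < k"
        using l sorted_wrt_nth_less[OF s(2)] by (metis less_asym linorder_neqE_nat)+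
      then show "cyc3 (the (\<alpha> x)) (the (\<alpha> y)) (the (\<alpha> z))" using A * by simp
    qed
  next
    assume B: ?B
    show ?A
    proof (intro allI impI)
      fix i j k assume l: "i < j \<and> j < k \<and> k < length s"
      then have "s ! i < s ! j" "s ! j < s ! k"
        using sorted_wrt_nth_less[OF s(2)] by auto
      moreover have "s ! i \<in> dom \<alpha>" "s ! j \<in> dom \<alpha>" "s ! k \<in> dom \<alpha>"
        unfolding s(1)[symmetric] using l by auto
      ultimately show "cyc3 (the (\<alpha> (s ! i))) (the (\<alpha> (s ! j))) (the (\<alpha> (s ! k)))"
        using B by blast
    qed
  qed
  also have "\<dots> \<longleftrightarrow> ?R"
  proof
    assume B: ?B
    show ?R
    proof (intro ballI impI)
      fix x y z assume xyz: "x \<in> dom \<alpha>" "y \<in> dom \<alpha>" "z \<in> dom \<alpha>" and "cyc3 x y z"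
      then consider "x < y \<and> y < z" | "y < z \<and> z < x" | "z < x \<and> x < y"
        unfolding cyc3_def by blast
      then have "cyc3 (the (\<alpha> x)) (the (\<alpha> y)) (the (\<alpha> z)) \<or>
          cyc3 (the (\<alpha> y)) (the (\<alpha> z)) (the (\<alpha> x)) \<or>
          cyc3 (the (\<alpha> z)) (the (\<alpha> x)) (the (\<alpha> y))"
        by cases (use B xyz in blast)+
      then show "cyc3 (the (\<alpha> x)) (the (\<alpha> y)) (the (\<alpha> z))"
        unfolding cyc3_def by blast
    qed
  next
    assume R: ?R
    show ?B
    proof (intro ballI impI)
      fix x y z assume "x \<in> dom \<alpha>" "y \<in> dom \<alpha>" "z \<in> dom \<alpha>" "x < y \<and> y < z"
      moreover from this have "cyc3 x y z" by (simp add: cyc3_def)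
      ultimately show "cyc3 (the (\<alpha> x)) (the (\<alpha> y)) (the (\<alpha> z))" using R by blast
    qed
  qed
  finally show ?thesis .
qed

lemma submonoid_OPDI: "submonoid (carrier (OPDI n)) (DI n)"
proof -
  interpret monoid "DI n" by (rule monoid_DI)
  have fin: "finite (dom \<alpha>)" if "\<alpha> \<in> carrier (DI n)" for \<alpha>
    using that finite_subset[of "dom \<alpha>" "{1..n}"] by (auto simp: DI_def PT_def)
  note iff = orientation_preserving_iff_cyc3[OF fin inj_on_DI]
  have "orientation_preserving \<one>\<^bsub>PT n\<^esub>"
    using one_closed by (simp add: iff dom_one_PT the_one_PT)
  moreover have "orientation_preserving (\<alpha> \<otimes>\<^bsub>PT n\<^esub> \<beta>)"
    if "\<alpha> \<in> carrier (DI n)" "\<beta> \<in> carrier (DI n)"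
      "orientation_preserving \<alpha>" "orientation_preserving \<beta>" for \<alpha> \<beta>
  proof -
    have "\<alpha> \<otimes>\<^bsub>PT n\<^esub> \<beta> \<in> carrier (DI n)" using m_closed[OF that(1,2)] by simp
    then show ?thesis
      using that(3,4) iff[OF that(1) that(1)] iff[OF that(2) that(2)]
      by (simp add: iff dom_mult_PT the_mult_PT)
  qed
  ultimately show ?thesis
    using m_closed one_closed by unfold_locales (auto simp: OPDI_def)
qed

lemma finite_carriers:
  "finite (carrier (ODI n))" "finite (carrier (MDI n))" "finite (carrier (OPDI n))"
  using finite_carrier_PT[of n] by (simp_all add: ODI_def MDI_def OPDI_def DI_def)

lemma monoids: "monoid (ODI n)" "monoid (MDI n)" "monoid (OPDI n)"
  using submonoid.submonoid_is_monoid[OF submonoid_ODI[of n] monoid_DI]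
    submonoid.submonoid_is_monoid[OF submonoid_MDI[of n] monoid_DI]
    submonoid.submonoid_is_monoid[OF submonoid_OPDI[of n] monoid_DI]
  by (simp_all add: ODI_def MDI_def OPDI_def)

end

(* Lower bounds: call a subset F of a monoid prime if 1 is not in F and ab in F forces a in F or
   b in F, i.e. if the complement of F is a submonoid. Every generating set meets every nonempty
   prime subset, so k pairwise disjoint nonempty prime subsets force rank at least k. In each of the
   three monoids a generating set is found with exactly one element in each member of such a family.

   A partial isometry with at least three points in its domain that preserves the order (resp. the
   orientation) is a restriction of a shift (resp. of a rotation). The remaining elements have
   rank 2: they turn the gap d of a pair into n - d (resp. swap a pair at cyclic distance d).
   Shifts are generated by the maps of rank n - 1, rotations by a single unit, and each exceptional
   gap needs one more generator. Every monotone map is order-preserving up to the reflection. *)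
theory Submission
  imports Defs
begin

section \<open>Ranks and prime subsets\<close>

text \<open>The ranks count what the units leave apart. In rank 2, \<open>ODI n\<close> must turn
  gap d into n - d and n - d into d by separate generators, which gives one class for each d < n
  other than n/2, a gap equal to its complement. The reflection preserves |x - y|, so
  \<open>MDI n\<close> has the same classes. Rotations identify the gaps d and n - d, so
  \<open>OPDI n\<close> has one class for each d below n/2. In rank n - 1 the classes are told apart
  by the omitted point i: all n of them in \<open>ODI n\<close>, the orbits {i, n + 1 - i} in
  \<open>MDI n\<close>, a single orbit in \<open>OPDI n\<close>. The last two monoids add one class
  for the nontrivial units. The delicate point is the ends of the chain, where partial identities
  are decomposable and must be kept out of the class; primality then rests on the fact that a total
  order-preserving isometry is the identity. The bound n >= 4 separates rank n - 1 from rank 2, so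
  that the two families of classes do not meet.\<close>

lemma monoid_rank_eqI:
  fixes G :: "'i \<Rightarrow> 'a" and F :: "'i \<Rightarrow> 'a set"
  assumes "monoid M" "finite I"
    and G: "\<And>i. i \<in> I \<Longrightarrow> G i \<in> carrier M" "\<And>i. i \<in> I \<Longrightarrow> G i \<in> F i"
    and gen: "carrier M \<subseteq> monoid_generate M (G ` I)"
    and one: "\<And>i. i \<in> I \<Longrightarrow> \<one>\<^bsub>M\<^esub> \<notin> F i"
    and prime: "\<And>i a b. \<lbrakk>i \<in> I; a \<in> carrier M; b \<in> carrier M; a \<otimes>\<^bsub>M\<^esub> b \<in> F i\<rbrakk> \<Longrightarrow> a \<in> F i \<or> b \<in> F i"
    and disj: "\<And>i j a. \<lbrakk>i \<in> I; j \<in> I; a \<in> carrier M; a \<in> F i; a \<in> F j\<rbrakk> \<Longrightarrow> i = j"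
  shows "monoid_rank M = card I"
  unfolding monoid_rank_def
proof (rule Least_equality)
  interpret monoid M by fact
  have inj: "inj_on G I"
  proof (rule inj_onI)
    fix i j assume "i \<in> I" "j \<in> I" "G i = G j"
    then show "i = j" using G[of i] G[of j] disj[of i j "G i"] by simp
  qed
  have "monoid_generate M (G ` I) = carrier M"
    using gen G(1) by (intro equalityI monoid_generate_subset[OF assms(1)]) auto
  then show "\<exists>X. X \<subseteq> carrier M \<and> finite X \<and> card X = card I \<and> monoid_generate M X = carrier M"
    using G(1) \<open>finite I\<close> card_image[OF inj] by (intro exI[of _ "G ` I"]) auto
next
  interpret monoid M by fact
  fix k assume "\<exists>X. X \<subseteq> carrier M \<and> finite X \<and> card X = k \<and> monoid_generate M X = carrier M"
  then obtain X where X: "X \<subseteq> carrier M" "finite X" "card X = k" "monoid_generate M X = carrier M"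
    by blast
  have "\<exists>x. x \<in> X \<and> x \<in> F i" if i: "i \<in> I" for i
  proof (rule ccontr)
    assume neg: "\<nexists>x. x \<in> X \<and> x \<in> F i"
    \<comment> \<open>Membership in the carrier is carried along, because primality is assumed for
      elements of M only.\<close>
    have "a \<in> carrier M \<and> a \<notin> F i" if "a \<in> monoid_generate M X" for a
      using that
    proof induction
      case one
      then show ?case using assms(6) i by simp
    next
      case (mult x y)
      then show ?case using neg prime[OF i, of x y] X(1) by auto
    qed
    then show False using G[OF i] X(4) by blast
  qed
  then obtain x where x: "\<And>i. i \<in> I \<Longrightarrow> x i \<in> X" "\<And>i. i \<in> I \<Longrightarrow> x i \<in> F i"
    by metis
  have "inj_on x I"
  proof (rule inj_onI)
    fix i j assume "i \<in> I" "j \<in> I" "x i = x j"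
    then show "i = j" using x[of i] x[of j] X(1) disj[of i j "x i"] by auto
  qed
  then have "card I \<le> card X"
    using x(1) X(2) by (intro card_inj_on_le) auto
  then show "card I \<le> k" using X(3) by simp
qed

section \<open>Submonoids generated by a set\<close>

lemma submonoid_monoid_generate:
  assumes "monoid M" "X \<subseteq> carrier M"
  shows "submonoid (monoid_generate M X) M"
proof
  interpret monoid M by fact
  note sub = monoid_generate_subset[OF assms]
  show "monoid_generate M X \<subseteq> carrier M" by (rule sub)
  show "\<one>\<^bsub>M\<^esub> \<in> monoid_generate M X" by (rule monoid_generate.one)
  fix a b assume "a \<in> monoid_generate M X" and b: "b \<in> monoid_generate M X"
  then show "a \<otimes>\<^bsub>M\<^esub> b \<in> monoid_generate M X"
  proof induction
    case one
    then show ?case using sub b by auto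
  next
    case (mult x y)
    moreover have "x \<in> carrier M" "y \<in> carrier M" "b \<in> carrier M"
      using mult sub b assms(2) by auto
    ultimately show ?case by (simp add: m_assoc monoid_generate.mult)
  qed
qed

lemma generator_in_monoid_generate:
  assumes "monoid M" "X \<subseteq> carrier M" "x \<in> X"
  shows "x \<in> monoid_generate M X"
proof -
  interpret monoid M by fact
  have "x \<otimes>\<^bsub>M\<^esub> \<one>\<^bsub>M\<^esub> \<in> monoid_generate M X"
    using assms(3) by (intro monoid_generate.intros)
  then show ?thesis using assms by auto
qed

lemma monoid_generate_mono_cong:
  assumes "mult M = mult N" "one M = one N"
  shows "monoid_generate M X \<subseteq> monoid_generate N X"
proof
  fix a assume "a \<in> monoid_generate M X"
  then show "a \<in> monoid_generate N X"
    by induction (auto simp: assms intro: monoid_generate.intros)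
qed

lemma monoid_generate_cong:
  assumes "mult M = mult N" "one M = one N"
  shows "monoid_generate M X = monoid_generate N X"
  using monoid_generate_mono_cong[OF assms] monoid_generate_mono_cong[OF assms[symmetric]]
  by (rule subset_antisym)

section \<open>Partial maps as restrictions of total functions, and membership as linear
  arithmetic\<close>

declare domIff [iff del]

definition ptrans :: "nat set \<Rightarrow> (nat \<Rightarrow> nat) \<Rightarrow> nat \<rightharpoonup> nat" where
  "ptrans A f = (Some \<circ> f) |` A"

lemma dom_ptrans [simp]: "dom (ptrans A f) = A"
  by (auto simp: ptrans_def dom_def restrict_map_def)

lemma the_ptrans [simp]: "x \<in> A \<Longrightarrow> the (ptrans A f x) = f x"
  by (simp add: ptrans_def)

lemma eq_ptransI: "dom \<alpha> = A \<Longrightarrow> (\<And>x. x \<in> A \<Longrightarrow> the (\<alpha> x) = f x) \<Longrightarrow> \<alpha> = ptrans A f"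
  by (rule ext) (force simp: ptrans_def restrict_map_def domIff)

lemma mult_ptrans:
  "ptrans A f \<otimes>\<^bsub>PT n\<^esub> ptrans B g = ptrans {x \<in> A. f x \<in> B} (\<lambda>x. g (f x))"
  by (rule eq_ptransI) (auto simp: dom_mult_PT the_mult_PT set_eq_iff)

lemma mult_ptrans_eq:
  assumes "f ` A \<subseteq> B" "\<And>x. x \<in> A \<Longrightarrow> g (f x) = h x"
  shows "ptrans A f \<otimes>\<^bsub>PT n\<^esub> ptrans B g = ptrans A h"
  using assms by (intro eq_ptransI) (auto simp: dom_mult_PT the_mult_PT set_eq_iff)

lemma one_PT_eq: "\<one>\<^bsub>PT n\<^esub> = ptrans {1..n} (\<lambda>x. x)"
  by (rule eq_ptransI) (auto simp: dom_one_PT the_one_PT)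

text \<open>The fold t -> min t (n - t) identifies exactly t and n - t. Trading the minimum for a
  disjunction of linear equations brings all later distance arguments into linear
  arithmetic.\<close>

lemma cycle_dist_eq_iff:
  assumes "x \<in> {1..n}" "y \<in> {1..n}" "x' \<in> {1..n}" "y' \<in> {1..n}"
  shows "cycle_dist n x' y' = cycle_dist n x y \<longleftrightarrow>
    \<bar>int x' - int y'\<bar> = \<bar>int x - int y\<bar> \<or> \<bar>int x' - int y'\<bar> = int n - \<bar>int x - int y\<bar>"
  using assms unfolding cycle_dist_def min_def by auto

lemma DI_iff:
  "\<alpha> \<in> carrier (DI n) \<longleftrightarrow> dom \<alpha> \<subseteq> {1..n} \<and> (\<forall>x\<in>dom \<alpha>. the (\<alpha> x) \<in> {1..n}) \<and>
    (\<forall>x\<in>dom \<alpha>. \<forall>y\<in>dom \<alpha>. \<bar>int (the (\<alpha> x)) - int (the (\<alpha> y))\<bar> = \<bar>int x - int y\<bar> \<or>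
       \<bar>int (the (\<alpha> x)) - int (the (\<alpha> y))\<bar> = int n - \<bar>int x - int y\<bar>)"
    (is "_ \<longleftrightarrow> ?D \<and> ?R \<and> ?I")
proof -
  have "ran \<alpha> \<subseteq> {1..n} \<longleftrightarrow> ?R" by (force simp: ran_def dom_def)
  then have "\<alpha> \<in> carrier (DI n) \<longleftrightarrow> ?D \<and> ?R \<and>
      (\<forall>x\<in>dom \<alpha>. \<forall>y\<in>dom \<alpha>. cycle_dist n (the (\<alpha> x)) (the (\<alpha> y)) = cycle_dist n x y)"
    unfolding DI_def PT_def by auto
  also have "\<dots> \<longleftrightarrow> ?D \<and> ?R \<and> ?I"
    by (intro conj_cong refl ball_cong cycle_dist_eq_iff) auto
  finally show ?thesis .
qed

lemma DI_dest:
  assumes "\<alpha> \<in> carrier (DI n)" "x \<in> dom \<alpha>"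
  shows "1 \<le> x" "x \<le> n" "1 \<le> the (\<alpha> x)" "the (\<alpha> x) \<le> n"
  using assms unfolding DI_iff by (auto dest: subsetD)

lemma DI_dist:
  assumes "\<alpha> \<in> carrier (DI n)" "x \<in> dom \<alpha>" "y \<in> dom \<alpha>"
  shows "\<bar>int (the (\<alpha> x)) - int (the (\<alpha> y))\<bar> = \<bar>int x - int y\<bar> \<or>
       \<bar>int (the (\<alpha> x)) - int (the (\<alpha> y))\<bar> = int n - \<bar>int x - int y\<bar>"
  using assms unfolding DI_iff by blast

lemma DI_inj:
  assumes "\<alpha> \<in> carrier (DI n)" "x \<in> dom \<alpha>" "y \<in> dom \<alpha>" "x \<noteq> y"
  shows "the (\<alpha> x) \<noteq> the (\<alpha> y)"
  using inj_on_DI[OF assms(1)] assms(2-) unfolding inj_on_def by blast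

lemma finite_dom_DI: "\<alpha> \<in> carrier (DI n) \<Longrightarrow> finite (dom \<alpha>)"
  using finite_subset[of "dom \<alpha>" "{1..n}"] by (auto simp: DI_iff)

text \<open>Isometries are injective, so weak monotonicity is the same as strict
  monotonicity.\<close>

lemma ODI_iff: "\<alpha> \<in> carrier (ODI n) \<longleftrightarrow> \<alpha> \<in> carrier (DI n) \<and>
    (\<forall>x\<in>dom \<alpha>. \<forall>y\<in>dom \<alpha>. x < y \<longrightarrow> the (\<alpha> x) < the (\<alpha> y))"
proof (cases "\<alpha> \<in> carrier (DI n)")
  case True
  then show ?thesis
    unfolding ODI_def order_preserving_def by (simp add: le_less) (metis DI_inj nat_neq_iff)
qed (simp add: ODI_def)

lemma MDI_iff: "\<alpha> \<in> carrier (MDI n) \<longleftrightarrow> \<alpha> \<in> carrier (DI n) \<and>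
    ((\<forall>x\<in>dom \<alpha>. \<forall>y\<in>dom \<alpha>. x < y \<longrightarrow> the (\<alpha> x) < the (\<alpha> y)) \<or>
     (\<forall>x\<in>dom \<alpha>. \<forall>y\<in>dom \<alpha>. x < y \<longrightarrow> the (\<alpha> y) < the (\<alpha> x)))"
proof (cases "\<alpha> \<in> carrier (DI n)")
  case True
  have "order_preserving \<alpha> \<longleftrightarrow> (\<forall>x\<in>dom \<alpha>. \<forall>y\<in>dom \<alpha>. x < y \<longrightarrow> the (\<alpha> x) < the (\<alpha> y))"
    unfolding order_preserving_def by (simp add: le_less) (metis DI_inj[OF True] nat_neq_iff)
  moreover have "order_reversing \<alpha> \<longleftrightarrow> (\<forall>x\<in>dom \<alpha>. \<forall>y\<in>dom \<alpha>. x < y \<longrightarrow> the (\<alpha> y) < the (\<alpha> x))"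
    unfolding order_reversing_def by (simp add: le_less) (metis DI_inj[OF True] nat_neq_iff)
  ultimately show ?thesis using True by (simp add: MDI_def monotone_ptrans_def)
qed (simp add: MDI_def)

lemma OPDI_iff: "\<alpha> \<in> carrier (OPDI n) \<longleftrightarrow> \<alpha> \<in> carrier (DI n) \<and>
    (\<forall>x\<in>dom \<alpha>. \<forall>y\<in>dom \<alpha>. \<forall>z\<in>dom \<alpha>. cyc3 x y z \<longrightarrow> cyc3 (the (\<alpha> x)) (the (\<alpha> y)) (the (\<alpha> z)))"
proof (cases "\<alpha> \<in> carrier (DI n)")
  case True
  then show ?thesis
    using orientation_preserving_iff_cyc3[OF finite_dom_DI[OF True] inj_on_DI[OF True]]
    by (simp add: OPDI_def)
qed (simp add: OPDI_def)

lemma mult_DI_submonoids [simp]: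
  "mult (ODI n) = mult (PT n)" "mult (MDI n) = mult (PT n)" "mult (OPDI n) = mult (PT n)"
  "one (ODI n) = one (PT n)" "one (MDI n) = one (PT n)" "one (OPDI n) = one (PT n)"
  by (simp_all add: ODI_def MDI_def OPDI_def)

text \<open>Generation refers only to product and unit, so all three monoids generate the same sets
  as \<open>PT n\<close>. Closure can then be used in one ambient monoid, whatever M is.\<close>

lemma generate_submonoid_PT:
  assumes "mult M = mult (PT n)" "one M = one (PT n)" "X \<subseteq> carrier (DI n)"
  shows "submonoid (monoid_generate M X) (PT n)" "X \<subseteq> monoid_generate M X"
proof -
  have X: "X \<subseteq> carrier (PT n)" using assms(3) by (auto simp: DI_def)
  show "submonoid (monoid_generate M X) (PT n)"
    using submonoid_monoid_generate[OF monoid_PT X] monoid_generate_cong[OF assms(1,2)] by simp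
  show "X \<subseteq> monoid_generate M X"
    using generator_in_monoid_generate[OF monoid_PT X] monoid_generate_cong[OF assms(1,2)] by auto
qed

section \<open>Rigidity on three points\<close>

text \<open>The outer gap is the sum of the inner two, before and after. Since the inner gaps are
  positive and the outer one is below n, complementing an inner gap breaks this additivity, unless
  that gap is n/2 and equals its complement.\<close>

lemma increasing_gaps_rigid:
  fixes a b c a' b' c' n :: int
  assumes "a < b" "b < c" "c - a < n" "a' < b'" "b' < c'"
    "\<bar>a' - b'\<bar> = \<bar>a - b\<bar> \<or> \<bar>a' - b'\<bar> = n - \<bar>a - b\<bar>"
    "\<bar>b' - c'\<bar> = \<bar>b - c\<bar> \<or> \<bar>b' - c'\<bar> = n - \<bar>b - c\<bar>"
    "\<bar>a' - c'\<bar> = \<bar>a - c\<bar> \<or> \<bar>a' - c'\<bar> = n - \<bar>a - c\<bar>"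
  shows "b' - a' = b - a \<and> c' - b' = c - b"
  using assms by auto

text \<open>If p became n - p, the other two new arcs would add up to p. But n - q = p + r and n - r
  = p + q exceed p, so q and r are kept; then q + r = p, and p is half of n and did not change after
  all.\<close>

lemma cyclic_gaps_rigid:
  fixes p q r p' q' r' n :: int
  assumes "0 < p" "0 < q" "0 < r" "p + q + r = n" "p' + q' + r' = n" "0 < p'" "0 < q'" "0 < r'"
    "p' = p \<or> p' = n - p" "q' = q \<or> q' = n - q" "r' = r \<or> r' = n - r"
  shows "p' = p \<and> q' = q \<and> r' = r"
  using assms(9-11) by (elim disjE) (use assms(1-8) in linarith)+

lemma int_gap_cases:
  fixes a b a' b' n :: int
  assumes "a < b" "b - a < n" "\<bar>a' - b'\<bar> = \<bar>a - b\<bar> \<or> \<bar>a' - b'\<bar> = n - \<bar>a - b\<bar>"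
  shows "a' < b' \<Longrightarrow> b' - a' = b - a \<or> b' - a' = n - (b - a)"
    and "b' < a' \<Longrightarrow> n + b' - a' = b - a \<or> n + b' - a' = n - (b - a)"
  using assms by linarith+

lemma ODI_gap_lt:
  assumes "\<alpha> \<in> carrier (ODI n)" "x \<in> dom \<alpha>" "y \<in> dom \<alpha>" "z \<in> dom \<alpha>" "x < y" "y < z"
  shows "int (the (\<alpha> y)) - int (the (\<alpha> x)) = int y - int x \<and>
         int (the (\<alpha> z)) - int (the (\<alpha> y)) = int z - int y"
proof -
  have a: "\<alpha> \<in> carrier (DI n)" and
    m: "the (\<alpha> x) < the (\<alpha> y)" "the (\<alpha> y) < the (\<alpha> z)"
    using assms by (auto simp: ODI_iff)
  show ?thesis
    using increasing_gaps_rigid[OF _ _ _ _ _ DI_dist[OF a assms(2,3)] DI_dist[OF a assms(3,4)]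
        DI_dist[OF a assms(2,4)]] m DI_dest[OF a assms(2)] DI_dest[OF a assms(4)] assms(5,6)
    by simp
qed

text \<open>A third point of the domain, wherever it lies, makes the difference of the other two
  rigid. Hence a distorted gap is possible only on a two-point domain.\<close>

lemma ODI_gap:
  assumes "\<alpha> \<in> carrier (ODI n)" "x \<in> dom \<alpha>" "y \<in> dom \<alpha>" "z \<in> dom \<alpha>" "z \<noteq> x" "z \<noteq> y"
  shows "int (the (\<alpha> y)) - int (the (\<alpha> x)) = int y - int x"
proof -
  have *: "int (the (\<alpha> y)) - int (the (\<alpha> x)) = int y - int x"
    if h: "x < y" "x \<in> dom \<alpha>" "y \<in> dom \<alpha>" "z \<noteq> x" "z \<noteq> y" for x y
  proof -
    consider "z < x" | "x < z" "z < y" | "y < z" using h(4,5) by linarith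
    then show ?thesis
    proof cases
      case 1
      then show ?thesis using ODI_gap_lt[OF assms(1,4) h(2,3)] h(1) by simp
    next
      case 2
      then show ?thesis using ODI_gap_lt[OF assms(1) h(2) assms(4) h(3)] by simp
    next
      case 3
      then show ?thesis using ODI_gap_lt[OF assms(1) h(2,3) assms(4)] h(1) by simp
    qed
  qed
  consider "x < y" | "x = y" | "y < x" by linarith
  then show ?thesis
    by cases (use *[of x y] *[of y x] assms in auto)
qed

lemma OPDI_gap_lt:
  assumes "\<alpha> \<in> carrier (OPDI n)" "x \<in> dom \<alpha>" "y \<in> dom \<alpha>" "z \<in> dom \<alpha>" "x < y" "y < z"
  defines "w \<equiv> (\<lambda>u. int (the (\<alpha> u)))"
  shows "w y - w x \<in> {int y - int x, int y - int x - int n} \<and>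
         w z - w y \<in> {int z - int y, int z - int y - int n} \<and>
         w z - w x \<in> {int z - int x, int z - int x - int n}"
proof -
  have a: "\<alpha> \<in> carrier (DI n)" using assms by (simp add: OPDI_iff)
  have "cyc3 (the (\<alpha> x)) (the (\<alpha> y)) (the (\<alpha> z))"
    using assms by (auto simp: OPDI_iff cyc3_def)
  have b: "1 \<le> w x" "w x \<le> int n" "1 \<le> w y" "w y \<le> int n" "1 \<le> w z" "w z \<le> int n" "1 \<le> x" "z \<le> n"
    using DI_dest[OF a assms(2)] DI_dest[OF a assms(3)] DI_dest[OF a assms(4)] by (auto simp: w_def)
  have xy: "w x < w y \<Longrightarrow> w y - w x = int y - int x \<or> w y - w x = int n - (int y - int x)"
    "w y < w x \<Longrightarrow> int n + w y - w x = int y - int x \<or> int n + w y - w x = int n - (int y - int x)"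
    using int_gap_cases[OF _ _ DI_dist[OF a assms(2,3)]] assms(5,6) b(7,8) by (simp_all add: w_def)
  have yz: "w y < w z \<Longrightarrow> w z - w y = int z - int y \<or> w z - w y = int n - (int z - int y)"
    "w z < w y \<Longrightarrow> int n + w z - w y = int z - int y \<or> int n + w z - w y = int n - (int z - int y)"
    using int_gap_cases[OF _ _ DI_dist[OF a assms(3,4)]] assms(5,6) b(7,8) by (simp_all add: w_def)
  \<comment> \<open>The third arc runs from z back to x past n; with length
    \<open>int n + int x - int z\<close> it completes the circle. In each of the three cyclic
    arrangements of the images exactly one of the image arcs wraps around.\<close>
  have xz: "w x < w z \<Longrightarrow> int n + w x - w z = int n + int x - int z \<or> int n + w x - w z = int n - (int n + int x - int z)"
    "w z < w x \<Longrightarrow> w x - w z = int n + int x - int z \<or> w x - w z = int n - (int n + int x - int z)"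
    using int_gap_cases[OF _ _ DI_dist[OF a assms(2,4)]] assms(5,6) b(7,8) by (simp_all add: w_def) linarith+
  consider "w x < w y" "w y < w z" | "w y < w z" "w z < w x" | "w z < w x" "w x < w y"
    using \<open>cyc3 _ _ _\<close> by (auto simp: w_def cyc3_def)
  then show ?thesis
  proof cases
    case 1
    then show ?thesis
      using cyclic_gaps_rigid[OF _ _ _ _ _ _ _ _ xy(1) yz(1) xz(1)] assms(5,6) b by simp
  next
    case 2
    then show ?thesis
      using cyclic_gaps_rigid[OF _ _ _ _ _ _ _ _ xy(2) yz(1) xz(2)] assms(5,6) b by simp
  next
    case 3
    then show ?thesis
      using cyclic_gaps_rigid[OF _ _ _ _ _ _ _ _ xy(1) yz(2) xz(2)] assms(5,6) b by simp
  qed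
qed

section \<open>Order-preserving partial isometries\<close>

text \<open>The normal form of a map turning gap d into n - d: source and image pair both start at
  1, which shifts on either side can always achieve.\<close>

definition gap_gen :: "nat \<Rightarrow> nat \<Rightarrow> nat \<rightharpoonup> nat" where
  "gap_gen n d = ptrans {1, 1 + d} (\<lambda>x. if x = 1 then 1 else 1 + n - d)"

lemma ODI_cases:
  assumes "\<alpha> \<in> carrier (ODI n)"
  obtains (shift) k where "\<And>x. x \<in> dom \<alpha> \<Longrightarrow> int (the (\<alpha> x)) = int x + k"
  | (gap) i d where "dom \<alpha> = {i, i + d}" "1 \<le> d" "d < n" "2 * d \<noteq> n"
      "the (\<alpha> (i + d)) + d = the (\<alpha> i) + n"
proof (cases "\<forall>x\<in>dom \<alpha>. \<forall>y\<in>dom \<alpha>. int (the (\<alpha> y)) - int (the (\<alpha> x)) = int y - int x")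
  case True
  show ?thesis
  proof (cases "dom \<alpha> = {}")
    case True
    \<comment> \<open>The empty map is a shift by any constant; \<open>0\<close> is an arbitrary
      choice.\<close>
    then show ?thesis by (intro shift[of 0]) auto
  next
    case False
    then obtain z where "z \<in> dom \<alpha>" by blast
    then show ?thesis using True by (intro shift[of "int (the (\<alpha> z)) - int z"]) force
  qed
next
  case False
  then obtain x y where xy: "x \<in> dom \<alpha>" "y \<in> dom \<alpha>"
    "int (the (\<alpha> y)) - int (the (\<alpha> x)) \<noteq> int y - int x" by blast
  define i j where "i = min x y" and "j = max x y"
  have ij: "i \<in> dom \<alpha>" "j \<in> dom \<alpha>" "int (the (\<alpha> j)) - int (the (\<alpha> i)) \<noteq> int j - int i" "i < j"
    using xy by (cases x y rule: linorder_cases; simp add: i_def j_def)+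
  have a: "\<alpha> \<in> carrier (DI n)" and m: "the (\<alpha> i) < the (\<alpha> j)"
    using assms ij by (auto simp: ODI_iff)
  have "dom \<alpha> = {i, j}"
    using ODI_gap[OF assms ij(1,2)] ij(1-3) by blast
  moreover have "int (the (\<alpha> j)) - int (the (\<alpha> i)) = int n - (int j - int i)"
    using DI_dist[OF a ij(1,2)] ij m by auto
  ultimately show ?thesis
    using ij m DI_dest[OF a ij(1)] DI_dest[OF a ij(2)] by (intro gap[of i "j - i"]) auto
qed

section \<open>Generating the order-preserving maps\<close>

lemma partial_identity_in_submonoid:
  assumes "submonoid S (PT n)" "\<And>i. i \<in> {1..n} \<Longrightarrow> ptrans ({1..n} - {i}) (\<lambda>x. x) \<in> S" "A \<subseteq> {1..n}"
  shows "ptrans A (\<lambda>x. x) \<in> S"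
proof -
  interpret submonoid S "PT n" by fact
  have "ptrans ({1..n} - B) (\<lambda>x. x) \<in> S" if "finite B" for B
    using that
  proof induction
    case empty
    then show ?case using one_closed by (simp add: one_PT_eq)
  next
    case (insert i B)
    \<comment> \<open>Removing a point outside \<open>{1..n}\<close> changes nothing, so B may be
      any finite set.\<close>
    have "ptrans ({1..n} - insert i B) (\<lambda>x. x) = ptrans ({1..n} - B) (\<lambda>x. x)" if "i \<notin> {1..n}"
      using that by (intro arg_cong2[of _ _ _ _ ptrans]) auto
    moreover have "ptrans ({1..n} - insert i B) (\<lambda>x. x) =
        ptrans ({1..n} - B) (\<lambda>x. x) \<otimes>\<^bsub>PT n\<^esub> ptrans ({1..n} - {i}) (\<lambda>x. x)"
      unfolding mult_ptrans by (intro arg_cong2[of _ _ _ _ ptrans]) auto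
    ultimately show ?case using insert.IH assms(2) m_closed by (cases "i \<in> {1..n}") auto
  qed
  from this[of "{1..n} - A"] show ?thesis
    using assms(3) by (simp add: double_diff)
qed

text \<open>A shift by k is the partial identity on A followed by k unit shifts; if the final image
  stays inside the chain, so do all the intermediate ones.\<close>

lemma shift_in_submonoid:
  assumes "submonoid S (PT n)" and id: "\<And>A. A \<subseteq> {1..n} \<Longrightarrow> ptrans A (\<lambda>x. x) \<in> S"
    and up: "ptrans ({1..n} - {n}) Suc \<in> S" and down: "ptrans ({1..n} - {1}) (\<lambda>x. x - 1) \<in> S"
    and A: "A \<subseteq> {1..n}"
  shows "(\<And>x. x \<in> A \<Longrightarrow> x + k \<le> n) \<Longrightarrow> ptrans A (\<lambda>x. x + k) \<in> S"
    and "(\<And>x. x \<in> A \<Longrightarrow> k < x) \<Longrightarrow> ptrans A (\<lambda>x. x - k) \<in> S"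
proof -
  interpret submonoid S "PT n" by fact
  show "ptrans A (\<lambda>x. x + k) \<in> S" if "\<And>x. x \<in> A \<Longrightarrow> x + k \<le> n"
    using that
  proof (induction k)
    case (Suc k)
    then have "ptrans A (\<lambda>x. x + k) \<in> S" by fastforce
    moreover have "ptrans A (\<lambda>x. x + k) \<otimes>\<^bsub>PT n\<^esub> ptrans ({1..n} - {n}) Suc = ptrans A (\<lambda>x. x + Suc k)"
      using A Suc.prems by (intro mult_ptrans_eq) fastforce+
    ultimately show ?case using m_closed up by metis
  qed (use id A in simp)
  show "ptrans A (\<lambda>x. x - k) \<in> S" if "\<And>x. x \<in> A \<Longrightarrow> k < x"
    using that
  proof (induction k)
    case (Suc k)
    then have "ptrans A (\<lambda>x. x - k) \<in> S" by fastforce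
    moreover have "ptrans A (\<lambda>x. x - k) \<otimes>\<^bsub>PT n\<^esub> ptrans ({1..n} - {1}) (\<lambda>x. x - 1) = ptrans A (\<lambda>x. x - Suc k)"
      using A Suc.prems by (intro mult_ptrans_eq) fastforce+
    ultimately show ?case using m_closed down by metis
  qed (use id A in simp)
qed

lemma ODI_subset_submonoid:
  assumes "submonoid S (PT n)"
    and up: "ptrans ({1..n} - {n}) Suc \<in> S" and down: "ptrans ({1..n} - {1}) (\<lambda>x. x - 1) \<in> S"
    and idem: "\<And>i. 1 < i \<Longrightarrow> i < n \<Longrightarrow> ptrans ({1..n} - {i}) (\<lambda>x. x) \<in> S"
    and gap_gens: "\<And>d. 1 \<le> d \<Longrightarrow> d < n \<Longrightarrow> 2 * d \<noteq> n \<Longrightarrow> gap_gen n d \<in> S"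
  shows "carrier (ODI n) \<subseteq> S"
proof
  interpret submonoid S "PT n" by fact
  have "ptrans ({1..n} - {n}) Suc \<otimes>\<^bsub>PT n\<^esub> ptrans ({1..n} - {1}) (\<lambda>x. x - 1) = ptrans ({1..n} - {n}) (\<lambda>x. x)"
    by (intro mult_ptrans_eq) auto
  then have n: "ptrans ({1..n} - {n}) (\<lambda>x. x) \<in> S" using m_closed[OF up down] by simp
  have "ptrans ({1..n} - {1}) (\<lambda>x. x - 1) \<otimes>\<^bsub>PT n\<^esub> ptrans ({1..n} - {n}) Suc = ptrans ({1..n} - {1}) (\<lambda>x. x)"
    by (intro mult_ptrans_eq) auto
  then have 1: "ptrans ({1..n} - {1}) (\<lambda>x. x) \<in> S" using m_closed[OF down up] by simp
  have "ptrans ({1..n} - {i}) (\<lambda>x. x) \<in> S" if "i \<in> {1..n}" for i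
    using that n 1 idem[of i] by (cases "i = 1"; cases "i = n") auto
  note shifts = shift_in_submonoid[OF assms(1) partial_identity_in_submonoid[OF assms(1) this] up down]
  \<comment> \<open>One integer offset covers both directions; the range condition keeps
    \<open>nat\<close> from truncating.\<close>
  have int_shift: "ptrans A (\<lambda>x. nat (int x + k)) \<in> S"
    if "A \<subseteq> {1..n}" "\<And>x. x \<in> A \<Longrightarrow> 1 \<le> int x + k \<and> int x + k \<le> int n" for A k
  proof (cases "k \<ge> 0")
    case True
    have "ptrans A (\<lambda>x. x + nat k) \<in> S"
      using that(2) True by (intro shifts that(1)) fastforce+
    moreover have "(\<lambda>x. x + nat k) = (\<lambda>x. nat (int x + k))" using True by (auto simp: fun_eq_iff)
    ultimately show ?thesis by simp
  next
    case False
    have "ptrans A (\<lambda>x. x - nat (- k)) \<in> S"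
      using that(2) False by (intro shifts that(1)) fastforce+
    moreover have "(\<lambda>x. x - nat (- k)) = (\<lambda>x. nat (int x + k))" using False by (auto simp: fun_eq_iff)
    ultimately show ?thesis by simp
  qed
  fix \<alpha> assume \<alpha>: "\<alpha> \<in> carrier (ODI n)"
  then have a: "\<alpha> \<in> carrier (DI n)" by (simp add: ODI_iff)
  then have dom: "dom \<alpha> \<subseteq> {1..n}" by (simp add: DI_iff)
  from \<alpha> show "\<alpha> \<in> S"
  proof (cases rule: ODI_cases)
    case (shift k)
    have "\<alpha> = ptrans (dom \<alpha>) (\<lambda>x. nat (int x + k))"
      using shift by (intro eq_ptransI) (auto simp flip: shift)
    moreover have "ptrans (dom \<alpha>) (\<lambda>x. nat (int x + k)) \<in> S"
      using DI_dest[OF a] by (intro int_shift dom)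
        (simp flip: shift)
    ultimately show ?thesis by simp
  next
    case (gap i d)
    \<comment> \<open>The pair is slid down to start at 1, its gap is changed there, and the result
      is slid up to start at the image of i.\<close>
    let ?l = "ptrans {i, i + d} (\<lambda>x. nat (int x + (1 - int i)))"
    let ?r = "ptrans {1, 1 + n - d} (\<lambda>x. nat (int x + (int (the (\<alpha> i)) - 1)))"
    have i: "i \<in> dom \<alpha>" "i + d \<in> dom \<alpha>" using gap(1) by auto
    note b = DI_dest[OF a i(1)] DI_dest[OF a i(2)]
    have "?l \<in> S" using b gap by (intro int_shift) auto
    moreover have "?r \<in> S" using b gap by (intro int_shift) auto
    ultimately have "?l \<otimes>\<^bsub>PT n\<^esub> gap_gen n d \<otimes>\<^bsub>PT n\<^esub> ?r \<in> S"
      using gap by (intro m_closed gap_gens) auto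
    moreover have "?l \<otimes>\<^bsub>PT n\<^esub> gap_gen n d = ptrans {i, i + d} (\<lambda>x. if x = i then 1 else 1 + n - d)"
      using gap unfolding gap_gen_def by (intro mult_ptrans_eq) auto
    moreover have "\<dots> \<otimes>\<^bsub>PT n\<^esub> ?r = ptrans {i, i + d} (\<lambda>x. the (\<alpha> x))"
      using gap b by (intro mult_ptrans_eq) (auto simp: nat_diff_distrib)
    moreover have "\<dots> = \<alpha>"
      using gap by (intro eq_ptransI[symmetric]) auto
    ultimately show ?thesis by simp
  qed
qed

text \<open>With 2 as third point, the images of 1 and n still differ by n - 1, which pins them to 1
  and n. Every other point then keeps its difference from 1.\<close>

lemma ODI_eq_id:
  assumes "\<alpha> \<in> carrier (ODI n)" "dom \<alpha> = {1..n}" "n \<ge> 3" "x \<in> dom \<alpha>"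
  shows "the (\<alpha> x) = x"
proof -
  have a: "\<alpha> \<in> carrier (DI n)" using assms by (simp add: ODI_iff)
  have d: "1 \<in> dom \<alpha>" "2 \<in> dom \<alpha>" "n \<in> dom \<alpha>" using assms by auto
  have n: "int (the (\<alpha> n)) - int (the (\<alpha> 1)) = int n - 1"
    using ODI_gap[OF assms(1) d(1,3,2)] assms(3) by simp
  then have 1: "the (\<alpha> 1) = 1" "the (\<alpha> n) = n"
    using DI_dest[OF a d(1)] DI_dest[OF a d(3)] assms(3) by linarith+
  show ?thesis
    using ODI_gap[OF assms(1) d(1) assms(4) d(3)] 1 assms(3) by (cases "x = 1"; cases "x = n") auto
qed

section \<open>Monotone partial isometries\<close>

definition refl_perm :: "nat \<Rightarrow> nat \<rightharpoonup> nat" where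
  "refl_perm n = ptrans {1..n} (\<lambda>x. n + 1 - x)"

lemma mult_refl_perm:
  assumes "\<alpha> \<in> carrier (DI n)"
  shows "dom (\<alpha> \<otimes>\<^bsub>PT n\<^esub> refl_perm n) = dom \<alpha>"
    and "x \<in> dom \<alpha> \<Longrightarrow> the ((\<alpha> \<otimes>\<^bsub>PT n\<^esub> refl_perm n) x) = n + 1 - the (\<alpha> x)"
proof -
  show d: "dom (\<alpha> \<otimes>\<^bsub>PT n\<^esub> refl_perm n) = dom \<alpha>"
    using DI_dest[OF assms] by (auto simp: dom_mult_PT refl_perm_def set_eq_iff)
  show "the ((\<alpha> \<otimes>\<^bsub>PT n\<^esub> refl_perm n) x) = n + 1 - the (\<alpha> x)" if "x \<in> dom \<alpha>"
    using that d DI_dest[OF assms that] by (simp add: the_mult_PT refl_perm_def)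
qed

lemma ODI_subset_MDI: "carrier (ODI n) \<subseteq> carrier (MDI n)"
  by (auto simp: ODI_iff MDI_iff)

lemma refl_perm_in_MDI: "refl_perm n \<in> carrier (MDI n)"
  unfolding MDI_iff DI_iff refl_perm_def by auto

lemma MDI_cases:
  assumes "\<alpha> \<in> carrier (MDI n)"
  shows "\<alpha> \<in> carrier (ODI n) \<or> \<alpha> \<otimes>\<^bsub>PT n\<^esub> refl_perm n \<in> carrier (ODI n)"
proof -
  have a: "\<alpha> \<in> carrier (DI n)" using assms by (simp add: MDI_iff)
  interpret monoid "MDI n" by (rule monoids)
  have "\<alpha> \<otimes>\<^bsub>PT n\<^esub> refl_perm n \<in> carrier (MDI n)"
    using m_closed[OF assms refl_perm_in_MDI] by simp
  then have "\<alpha> \<otimes>\<^bsub>PT n\<^esub> refl_perm n \<in> carrier (DI n)" by (simp add: MDI_iff)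
  then show ?thesis
    using assms DI_dest(4)[OF a] unfolding MDI_iff ODI_iff
    by (auto simp: mult_refl_perm[OF a] less_Suc_eq_le intro!: diff_less_mono2)
qed

text \<open>The reflection preserves absolute differences, so rigidity passes from order-preserving
  to monotone maps.\<close>

lemma MDI_gap:
  assumes "\<alpha> \<in> carrier (MDI n)" "x \<in> dom \<alpha>" "y \<in> dom \<alpha>" "z \<in> dom \<alpha>" "z \<noteq> x" "z \<noteq> y"
  shows "\<bar>int (the (\<alpha> x)) - int (the (\<alpha> y))\<bar> = \<bar>int x - int y\<bar>"
  using MDI_cases[OF assms(1)]
proof
  assume "\<alpha> \<in> carrier (ODI n)"
  from ODI_gap[OF this assms(2-)] show ?thesis by auto
next
  assume b: "\<alpha> \<otimes>\<^bsub>PT n\<^esub> refl_perm n \<in> carrier (ODI n)"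
  have a: "\<alpha> \<in> carrier (DI n)" using assms by (simp add: MDI_iff)
  show ?thesis
    using ODI_gap[OF b, of x y z] assms DI_dest[OF a assms(2)] DI_dest[OF a assms(3)]
    by (simp add: mult_refl_perm[OF a])
qed

text \<open>Extendability to a unit survives products; among maps of rank n - 1 that omit an end
  point, its failure singles out the shifts and their reflected versions.\<close>

definition restricts_unit :: "nat \<Rightarrow> (nat \<rightharpoonup> nat) \<Rightarrow> bool" where
  "restricts_unit n \<alpha> \<longleftrightarrow> (\<forall>x\<in>dom \<alpha>. the (\<alpha> x) = x) \<or> (\<forall>x\<in>dom \<alpha>. the (\<alpha> x) = n + 1 - x)"

lemma MDI_restricts_unit:
  assumes "\<alpha> \<in> carrier (MDI n)" "dom \<alpha> = {1..n}" "n \<ge> 3"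
  shows "restricts_unit n \<alpha>"
  using MDI_cases[OF assms(1)]
proof
  assume "\<alpha> \<in> carrier (ODI n)"
  then show ?thesis using ODI_eq_id assms unfolding restricts_unit_def by blast
next
  assume b: "\<alpha> \<otimes>\<^bsub>PT n\<^esub> refl_perm n \<in> carrier (ODI n)"
  have a: "\<alpha> \<in> carrier (DI n)" using assms by (simp add: MDI_iff)
  have "the (\<alpha> x) = n + 1 - x" if "x \<in> dom \<alpha>" for x
    using ODI_eq_id[OF b, of x] assms DI_dest[OF a that] that by (simp add: mult_refl_perm[OF a])
  then show ?thesis unfolding restricts_unit_def by blast
qed

section \<open>Gap-changing maps\<close>

text \<open>Absolute values make the class blind to the reflection, so one family serves both
  \<open>ODI n\<close> and \<open>MDI n\<close>.\<close>

definition gap_class :: "nat \<Rightarrow> nat \<Rightarrow> (nat \<rightharpoonup> nat) set" where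
  "gap_class n d = {\<alpha>. \<exists>x\<in>dom \<alpha>. \<exists>y\<in>dom \<alpha>.
     \<bar>int x - int y\<bar> = int d \<and> \<bar>int (the (\<alpha> x)) - int (the (\<alpha> y))\<bar> = int n - int d}"

text \<open>Follow the pair through the product: either \<alpha> already turns gap d into n - d, or
  it keeps gap d and \<beta> must do so.\<close>

lemma gap_class_prime:
  assumes "\<alpha> \<in> carrier (DI n)" "\<beta> \<in> carrier (DI n)" "\<alpha> \<otimes>\<^bsub>PT n\<^esub> \<beta> \<in> gap_class n d"
  shows "\<alpha> \<in> gap_class n d \<or> \<beta> \<in> gap_class n d"
proof -
  obtain x y where xy: "x \<in> dom (\<alpha> \<otimes>\<^bsub>PT n\<^esub> \<beta>)" "y \<in> dom (\<alpha> \<otimes>\<^bsub>PT n\<^esub> \<beta>)" "\<bar>int x - int y\<bar> = int d"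
    "\<bar>int (the (\<beta> (the (\<alpha> x)))) - int (the (\<beta> (the (\<alpha> y))))\<bar> = int n - int d"
    using assms(3) by (auto simp: gap_class_def the_mult_PT)
  have d: "x \<in> dom \<alpha>" "y \<in> dom \<alpha>" "the (\<alpha> x) \<in> dom \<beta>" "the (\<alpha> y) \<in> dom \<beta>"
    using xy by (auto simp: dom_mult_PT)
  from DI_dist[OF assms(1) d(1,2)] show ?thesis
    using xy d unfolding gap_class_def by auto
qed

lemma gap_class_MDI:
  assumes "\<alpha> \<in> carrier (MDI n)" "\<alpha> \<in> gap_class n d" "2 * d \<noteq> n"
  obtains x y where "dom \<alpha> = {x, y}" "\<bar>int x - int y\<bar> = int d"
proof -
  obtain x y where xy: "x \<in> dom \<alpha>" "y \<in> dom \<alpha>" "\<bar>int x - int y\<bar> = int d"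
    "\<bar>int (the (\<alpha> x)) - int (the (\<alpha> y))\<bar> = int n - int d"
    using assms(2) by (auto simp: gap_class_def)
  have "z = x \<or> z = y" if "z \<in> dom \<alpha>" for z
    using MDI_gap[OF assms(1) xy(1,2) that] xy(3,4) assms(3) by auto
  then show ?thesis using xy by (intro that[of x y]) auto
qed

text \<open>The domain is nothing but the distorted pair, so d can be read off from the
  domain.\<close>

lemma gap_class_disjoint:
  assumes "\<alpha> \<in> carrier (MDI n)" "\<alpha> \<in> gap_class n d" "\<alpha> \<in> gap_class n d'" "2 * d \<noteq> n" "2 * d' \<noteq> n"
    "0 < d" "0 < d'"
  shows "d = d'"
proof -
  obtain x y where "dom \<alpha> = {x, y}" "\<bar>int x - int y\<bar> = int d"
    by (rule gap_class_MDI[OF assms(1,2,4)])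
  moreover obtain x' y' where "dom \<alpha> = {x', y'}" "\<bar>int x' - int y'\<bar> = int d'"
    by (rule gap_class_MDI[OF assms(1,3,5)])
  ultimately show ?thesis using assms(6,7) by (auto simp: doubleton_eq_iff)
qed

lemma card_dom_gap_class:
  assumes "\<alpha> \<in> carrier (MDI n)" "\<alpha> \<in> gap_class n d" "2 * d \<noteq> n"
  shows "card (dom \<alpha>) \<le> 2"
proof -
  obtain x y where "dom \<alpha> = {x, y}" by (rule gap_class_MDI[OF assms])
  then show ?thesis by (simp add: card_insert_le_m1)
qed

lemma gap_gen_in_ODI: "0 < d \<Longrightarrow> d < n \<Longrightarrow> gap_gen n d \<in> carrier (ODI n)"
  unfolding ODI_iff DI_iff gap_gen_def by auto

lemma gap_gen_in_gap_class: "0 < d \<Longrightarrow> d < n \<Longrightarrow> gap_gen n d \<in> gap_class n d"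
  unfolding gap_gen_def gap_class_def by auto

lemma one_notin_gap_class: "2 * d \<noteq> n \<Longrightarrow> \<one>\<^bsub>PT n\<^esub> \<notin> gap_class n d"
  unfolding one_PT_eq gap_class_def by auto

section \<open>The rank of the monoid of order-preserving partial isometries\<close>

text \<open>For even n the gap n/2 drops out and n - 2 values are left; for odd n all n - 1 remain.
  Both numbers are \<open>2 * ((n - 1) div 2)\<close>.\<close>

lemma card_nonhalf_gaps:
  assumes "n \<ge> 1"
  shows "finite {d. 1 \<le> d \<and> d < n \<and> 2 * d \<noteq> n}"
    and "card {d. 1 \<le> d \<and> d < n \<and> 2 * d \<noteq> n} = 2 * ((n - 1) div 2)"
proof -
  have *: "{d. 1 \<le> d \<and> d < n \<and> 2 * d \<noteq> n} = (if even n then {1..<n} - {n div 2} else {1..<n})"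
    by (auto elim!: evenE)
  show "finite {d. 1 \<le> d \<and> d < n \<and> 2 * d \<noteq> n}" unfolding * by simp
  show "card {d. 1 \<le> d \<and> d < n \<and> 2 * d \<noteq> n} = 2 * ((n - 1) div 2)"
    unfolding * using assms by (auto elim!: evenE oddE simp: card_Diff_singleton_if)
qed

section \<open>Order-preserving maps of rank n - 1\<close>

lemma subset_minus_point_cases:
  assumes "A \<subseteq> U" "U - {i} \<subseteq> A"
  shows "A = U \<or> A = U - {i}"
  using assms by auto

text \<open>The index is the point missing from the domain. At the two ends the unit shift takes the
  place of the partial identity.\<close>

definition ODI_gen :: "nat \<Rightarrow> nat \<Rightarrow> nat \<rightharpoonup> nat" where
  "ODI_gen n i = ptrans ({1..n} - {i}) (if i = 1 then (\<lambda>x. x - 1) else if i = n then Suc else (\<lambda>x. x))"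

text \<open>Restrictions of the identity are excluded for the endpoints \<open>i = 1\<close> and \<open>i = n\<close>: they are
  products of the two shifts of rank \<open>n - 1\<close>.\<close>

definition ODI_class :: "nat \<Rightarrow> nat \<Rightarrow> (nat \<rightharpoonup> nat) set" where
  "ODI_class n i = {\<alpha>. dom \<alpha> = {1..n} - {i} \<and> (i = 1 \<or> i = n \<longrightarrow> (\<exists>x\<in>dom \<alpha>. the (\<alpha> x) \<noteq> x))}"

lemma ODI_gen_in_ODI: "ODI_gen n i \<in> carrier (ODI n)"
  unfolding ODI_iff DI_iff ODI_gen_def by auto

lemma ODI_gen_in_class:
  assumes "n \<ge> 2"
  shows "ODI_gen n i \<in> ODI_class n i"
proof -
  have "\<exists>x\<in>{1..n} - {i}. the (ODI_gen n i x) \<noteq> x" if "i = 1 \<or> i = n"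
  proof (cases "i = 1")
    case True
    then show ?thesis using assms by (intro bexI[of _ 2]) (auto simp: ODI_gen_def)
  next
    case False
    then show ?thesis using assms that by (intro bexI[of _ 1]) (auto simp: ODI_gen_def)
  qed
  moreover have "dom (ODI_gen n i) = {1..n} - {i}" by (simp add: ODI_gen_def)
  ultimately show ?thesis unfolding ODI_class_def by blast
qed

lemma one_notin_ODI_class:
  assumes "i \<in> {1..n}"
  shows "\<one>\<^bsub>PT n\<^esub> \<notin> ODI_class n i"
proof -
  have "{1..n} \<noteq> {1..n} - {i}" using assms by blast
  then show ?thesis unfolding ODI_class_def dom_one_PT mem_Collect_eq by blast
qed

text \<open>A factor outside the class whose domain misses at most i is a partial identity. If both
  factors are such, so is the product, which the class forbids for an end point; for an interior i
  both factors must even be total, and then so is the product.\<close>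

lemma ODI_class_prime:
  assumes n: "n \<ge> 3" and ab: "\<alpha> \<in> carrier (ODI n)" "\<beta> \<in> carrier (ODI n)"
    and m: "\<alpha> \<otimes>\<^bsub>PT n\<^esub> \<beta> \<in> ODI_class n i"
  shows "\<alpha> \<in> ODI_class n i \<or> \<beta> \<in> ODI_class n i"
proof (rule ccontr)
  assume neg: "\<not> ?thesis"
  have sub: "dom \<alpha> \<subseteq> {1..n}" "dom \<beta> \<subseteq> {1..n}" using ab by (auto simp: ODI_iff DI_iff)
  have id: "the (\<gamma> x) = x"
    if "\<gamma> \<in> carrier (ODI n)" "\<gamma> \<notin> ODI_class n i" "dom \<gamma> \<subseteq> {1..n}" "{1..n} - {i} \<subseteq> dom \<gamma>" "x \<in> dom \<gamma>"
    for \<gamma> x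
    using subset_minus_point_cases[OF that(3,4)]
  proof
    assume "dom \<gamma> = {1..n}"
    then show ?thesis using ODI_eq_id that n by blast
  next
    assume "dom \<gamma> = {1..n} - {i}"
    then show ?thesis using that(2,5) unfolding ODI_class_def by blast
  qed
  have dom: "dom (\<alpha> \<otimes>\<^bsub>PT n\<^esub> \<beta>) = {1..n} - {i}" using m by (simp add: ODI_class_def)
  have da: "{1..n} - {i} \<subseteq> dom \<alpha>"
    unfolding dom[symmetric] by (simp add: dom_mult_PT subset_iff)
  have a: "the (\<alpha> x) = x" if "x \<in> dom \<alpha>" for x
    using id[OF ab(1) _ sub(1) da that] neg by blast
  have dm: "x \<in> dom (\<alpha> \<otimes>\<^bsub>PT n\<^esub> \<beta>) \<longleftrightarrow> x \<in> dom \<alpha> \<and> x \<in> dom \<beta>" for x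
    using a[of x] by (auto simp: dom_mult_PT)
  then have db: "{1..n} - {i} \<subseteq> dom \<beta>"
    unfolding dom[symmetric] by blast
  have b: "the (\<beta> x) = x" if "x \<in> dom \<beta>" for x
    using id[OF ab(2) _ sub(2) db that] neg by blast
  have "the ((\<alpha> \<otimes>\<^bsub>PT n\<^esub> \<beta>) x) = x" if "x \<in> dom (\<alpha> \<otimes>\<^bsub>PT n\<^esub> \<beta>)" for x
    using that a[of x] b[of x] by (simp add: dm the_mult_PT)
  then have i: "i \<noteq> 1" "i \<noteq> n" using m unfolding ODI_class_def by blast+
  have ne: "dom \<alpha> \<noteq> {1..n} - {i}" "dom \<beta> \<noteq> {1..n} - {i}"
    using neg i by (simp_all add: ODI_class_def)
  then have "dom \<alpha> = {1..n}" "dom \<beta> = {1..n}"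
    using subset_minus_point_cases[OF sub(1) da] subset_minus_point_cases[OF sub(2) db] by blast+
  then have "dom (\<alpha> \<otimes>\<^bsub>PT n\<^esub> \<beta>) = dom \<alpha>" using dm by blast
  then show False using dom ne by simp
qed

theorem rank_ODI:
  assumes n: "n \<ge> 4"
  shows "monoid_rank (ODI n) = n + 2 * ((n - 1) div 2)"
proof -
  define D where "D = {d. 1 \<le> d \<and> d < n \<and> 2 * d \<noteq> n}"
  have D: "finite D" "card D = 2 * ((n - 1) div 2)"
    using card_nonhalf_gaps[of n] n by (simp_all add: D_def)
  define I where "I = {1..n} <+> D"
  define G where "G = case_sum (ODI_gen n) (gap_gen n)"
  define F where "F = case_sum (ODI_class n) (gap_class n)"
  have G: "G i \<in> carrier (ODI n)" if "i \<in> I" for i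
    using that ODI_gen_in_ODI gap_gen_in_ODI by (auto simp: I_def G_def D_def)
  have card_class: "card (dom a) = n - 1" if "a \<in> ODI_class n i" "i \<in> {1..n}" for a i
    using that by (simp add: ODI_class_def)
  have disj: "k = l" if "a \<in> F (Inl k)" "a \<in> F (Inl l)" "Inl k \<in> I" "Inl l \<in> I" for a k l
  proof -
    have "{1..n} - dom a = {k}" "{1..n} - dom a = {l}"
      using that by (auto simp: F_def I_def ODI_class_def double_diff)
    then show ?thesis by simp
  qed
  have disj': False
    if a: "a \<in> carrier (ODI n)" "a \<in> F (Inl k)" "a \<in> F (Inr d)" "Inl k \<in> I" "Inr d \<in> I" for a k d
  proof -
    have "card (dom a) = n - 1" using a(2,4) by (intro card_class[of a k]) (auto simp: F_def I_def)
    moreover have "card (dom a) \<le> 2"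
      using a(1,3,5) ODI_subset_MDI by (intro card_dom_gap_class[of a n d]) (auto simp: F_def I_def D_def)
    ultimately show False using n by simp
  qed
  have disj'': "d = e"
    if "a \<in> carrier (ODI n)" "a \<in> F (Inr d)" "a \<in> F (Inr e)" "Inr d \<in> I" "Inr e \<in> I" for a d e
    using that ODI_subset_MDI by (intro gap_class_disjoint[of a n]) (auto simp: F_def I_def D_def)
  have "monoid_rank (ODI n) = card I"
  proof (rule monoid_rank_eqI[where F = F and G = G])
    show "carrier (ODI n) \<subseteq> monoid_generate (ODI n) (G ` I)"
    proof (rule ODI_subset_submonoid)
      have GI: "G ` I \<subseteq> carrier (DI n)" using G by (auto simp: ODI_iff)
      show "submonoid (monoid_generate (ODI n) (G ` I)) (PT n)"
        by (rule generate_submonoid_PT) (use GI in simp_all)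
      have sub: "G ` I \<subseteq> monoid_generate (ODI n) (G ` I)"
        by (rule generate_submonoid_PT) (use GI in simp_all)
      have gen: "ODI_gen n i \<in> monoid_generate (ODI n) (G ` I)" if "1 \<le> i" "i \<le> n" for i
      proof -
        have "G (Inl i) \<in> G ` I" using that by (auto simp: I_def)
        then show ?thesis using sub by (auto simp: G_def)
      qed
      show "ptrans ({1..n} - {n}) Suc \<in> monoid_generate (ODI n) (G ` I)"
        using gen[of n] n by (simp add: ODI_gen_def)
      show "ptrans ({1..n} - {1}) (\<lambda>x. x - 1) \<in> monoid_generate (ODI n) (G ` I)"
        using gen[of 1] n by (simp add: ODI_gen_def)
      show "ptrans ({1..n} - {i}) (\<lambda>x. x) \<in> monoid_generate (ODI n) (G ` I)" if "1 < i" "i < n" for i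
        using gen[of i] that by (simp add: ODI_gen_def)
      show "gap_gen n d \<in> monoid_generate (ODI n) (G ` I)" if "1 \<le> d" "d < n" "2 * d \<noteq> n" for d
      proof -
        have "G (Inr d) \<in> G ` I" using that by (auto simp: I_def D_def)
        then show ?thesis using sub by (auto simp: G_def)
      qed
    qed
    show "G i \<in> F i" if "i \<in> I" for i
      using that n ODI_gen_in_class gap_gen_in_gap_class by (auto simp: I_def G_def F_def D_def)
    show "\<one>\<^bsub>ODI n\<^esub> \<notin> F i" if "i \<in> I" for i
      using that one_notin_gap_class one_notin_ODI_class by (auto simp: I_def F_def D_def)
    show "a \<in> F i \<or> b \<in> F i"
      if "i \<in> I" "a \<in> carrier (ODI n)" "b \<in> carrier (ODI n)" "a \<otimes>\<^bsub>ODI n\<^esub> b \<in> F i" for i a b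
    proof (cases i)
      case (Inl k)
      then show ?thesis using ODI_class_prime[of n a b k] that n by (simp add: F_def)
    next
      case (Inr d)
      then show ?thesis using gap_class_prime[of a n b d] that by (simp add: F_def ODI_iff)
    qed
    show "i = j" if "i \<in> I" "j \<in> I" "a \<in> carrier (ODI n)" "a \<in> F i" "a \<in> F j" for i j a
      using that by (cases i; cases j; simp; blast dest: disj disj' disj'')
  qed (use D G monoids in \<open>auto simp: I_def\<close>)
  also have "card I = n + 2 * ((n - 1) div 2)"
    using D by (simp add: I_def card_Plus)
  finally show ?thesis .
qed

section \<open>The rank of the monoid of monotone partial isometries\<close>

text \<open>Conjugation by the reflection exchanges the omitted points i and n + 1 - i and turns the
  shift up into the shift down. Hence only indices up to (n + 1) div 2 will be used.\<close>

definition MDI_gen :: "nat \<Rightarrow> nat \<Rightarrow> nat \<rightharpoonup> nat" where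
  "MDI_gen n i = (if i = 0 then refl_perm n
     else if i = 1 then ptrans ({1..n} - {n}) Suc else ptrans ({1..n} - {i}) (\<lambda>x. x))"

text \<open>Index \<open>0\<close> stands for the nontrivial unit, index \<open>1\<close> for the shifts of rank \<open>n - 1\<close> and
  their reflected versions.\<close>

definition MDI_class :: "nat \<Rightarrow> nat \<Rightarrow> (nat \<rightharpoonup> nat) set" where
  "MDI_class n i = {\<alpha>. if i = 0 then dom \<alpha> = {1..n} \<and> (\<exists>x\<in>dom \<alpha>. the (\<alpha> x) \<noteq> x)
     else (dom \<alpha> = {1..n} - {i} \<or> dom \<alpha> = {1..n} - {n + 1 - i}) \<and> (i = 1 \<longrightarrow> \<not> restricts_unit n \<alpha>)}"

lemma MDI_gen_in_MDI: "MDI_gen n i \<in> carrier (MDI n)"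
  using refl_perm_in_MDI unfolding MDI_gen_def by (auto simp: MDI_iff DI_iff)

lemma MDI_gen_in_class:
  assumes "n \<ge> 3"
  shows "MDI_gen n i \<in> MDI_class n i"
proof -
  have "\<not> restricts_unit n (ptrans ({1..n} - {n}) Suc)"
  proof
    \<comment> \<open>The point 1 refutes the identity; agreement with the reflection at 1 and 2
      would require both \<open>2 = n\<close> and \<open>3 = n - 1\<close>.\<close>
    have x: "1 \<in> {1..n} - {n}" "2 \<in> {1..n} - {n}" using assms by auto
    assume "restricts_unit n (ptrans ({1..n} - {n}) Suc)"
    then have "Suc 1 = 1 \<or> Suc 1 = n + 1 - 1 \<and> Suc 2 = n + 1 - 2"
      unfolding restricts_unit_def dom_ptrans using x by (metis the_ptrans)
    then show False by linarith
  qed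
  moreover have "\<exists>x\<in>dom (refl_perm n). the (refl_perm n x) \<noteq> x" "dom (refl_perm n) = {1..n}"
    using assms by (auto simp: refl_perm_def intro!: bexI[of _ 1])
  ultimately show ?thesis
    unfolding MDI_class_def MDI_gen_def by (simp del: One_nat_def)
qed

text \<open>The four cases are the multiplication table of the group of order two formed by the
  identity and the reflection.\<close>

lemma restricts_unit_mult:
  assumes "\<alpha> \<in> carrier (DI n)" "restricts_unit n \<alpha>" "restricts_unit n \<beta>"
  shows "restricts_unit n (\<alpha> \<otimes>\<^bsub>PT n\<^esub> \<beta>)"
proof -
  have c: "x \<in> dom \<alpha>" "the (\<alpha> x) \<in> dom \<beta>" "x \<le> n"
    "the ((\<alpha> \<otimes>\<^bsub>PT n\<^esub> \<beta>) x) = the (\<beta> (the (\<alpha> x)))" if "x \<in> dom (\<alpha> \<otimes>\<^bsub>PT n\<^esub> \<beta>)" for x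
    using that DI_dest(2)[OF assms(1)] by (auto simp: dom_mult_PT the_mult_PT)
  from assms(2)[unfolded restricts_unit_def] assms(3)[unfolded restricts_unit_def] show ?thesis
    unfolding restricts_unit_def
  proof (elim disjE, goal_cases)
    case 1
    then show ?case using c by force
  next
    case 2
    then show ?case using c by (intro disjI2) force
  next
    case 3
    then show ?case using c by (intro disjI2) force
  next
    case 4
    then show ?case using c by (intro disjI1) force
  qed
qed

lemma one_notin_MDI_class:
  assumes "i \<le> n"
  shows "\<one>\<^bsub>PT n\<^esub> \<notin> MDI_class n i"
proof (cases "i = 0")
  case True
  then show ?thesis by (simp add: MDI_class_def dom_one_PT the_one_PT)
next
  case False
  then have "i \<in> {1..n}" "n + 1 - i \<in> {1..n}" using assms by auto
  then have "{1..n} \<noteq> {1..n} - {i}" "{1..n} \<noteq> {1..n} - {n + 1 - i}" by blast+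
  then show ?thesis using False unfolding MDI_class_def dom_one_PT mem_Collect_eq by presburger
qed

text \<open>The domain of \<beta> contains the image under \<alpha> of the domain of the product,
  and this image omits i or its mirror point only.\<close>

lemma restricts_unit_dom_mult:
  assumes "\<alpha> \<in> carrier (DI n)" "restricts_unit n \<alpha>" "dom (\<alpha> \<otimes>\<^bsub>PT n\<^esub> \<beta>) = {1..n} - {i}" "i \<in> {1..n}"
  shows "{1..n} - {i} \<subseteq> dom \<beta> \<or> {1..n} - {n + 1 - i} \<subseteq> dom \<beta>"
  using assms(2) unfolding restricts_unit_def
proof
  assume "\<forall>x\<in>dom \<alpha>. the (\<alpha> x) = x"
  then have "dom (\<alpha> \<otimes>\<^bsub>PT n\<^esub> \<beta>) \<subseteq> dom \<beta>" by (auto simp: dom_mult_PT)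
  then show ?thesis using assms(3) by blast
next
  assume r: "\<forall>x\<in>dom \<alpha>. the (\<alpha> x) = n + 1 - x"
  have "x \<in> dom \<beta>" if "x \<in> {1..n} - {n + 1 - i}" for x
  proof -
    have "n + 1 - x \<in> {1..n} - {i}" using that assms(4) by auto
    then have "n + 1 - x \<in> dom (\<alpha> \<otimes>\<^bsub>PT n\<^esub> \<beta>)" using assms(3) by simp
    then have "the (\<alpha> (n + 1 - x)) \<in> dom \<beta>" "n + 1 - x \<in> dom \<alpha>" by (auto simp: dom_mult_PT)
    then show ?thesis using r that by auto
  qed
  then show ?thesis by blast
qed

text \<open>For \<open>i = 0\<close>, total factors outside the class are identities. For i > 0, a
  factor outside the class with almost full domain restricts a unit. Then the product restricts a
  unit too, which settles \<open>i = 1\<close>; for larger i both factors are total and the product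
  cannot miss a point.\<close>

lemma MDI_class_prime:
  assumes n: "n \<ge> 3" and ab: "\<alpha> \<in> carrier (MDI n)" "\<beta> \<in> carrier (MDI n)"
    and m: "\<alpha> \<otimes>\<^bsub>PT n\<^esub> \<beta> \<in> MDI_class n i" and i: "i \<le> n"
  shows "\<alpha> \<in> MDI_class n i \<or> \<beta> \<in> MDI_class n i"
proof (rule ccontr)
  assume neg: "\<not> ?thesis"
  have a: "\<alpha> \<in> carrier (DI n)" and sub: "dom \<alpha> \<subseteq> {1..n}" "dom \<beta> \<subseteq> {1..n}"
    using ab by (auto simp: MDI_iff DI_iff)
  show False
  proof (cases "i = 0")
    case True
    then have dom: "dom (\<alpha> \<otimes>\<^bsub>PT n\<^esub> \<beta>) = {1..n}" using m by (simp add: MDI_class_def)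
    have im: "x \<in> dom \<alpha>" "the (\<alpha> x) \<in> dom \<beta>" if "x \<in> {1..n}" for x
      using that unfolding dom[symmetric] by (simp_all add: dom_mult_PT)
    have da: "dom \<alpha> = {1..n}" using im(1) sub(1) by blast
    have id: "the (\<alpha> x) = x" if "x \<in> {1..n}" for x
      using neg True that da by (simp add: MDI_class_def)
    have db: "dom \<beta> = {1..n}" using im(2) id sub(2) by force
    have id': "the (\<beta> x) = x" if "x \<in> {1..n}" for x
      using neg True that db by (simp add: MDI_class_def)
    have "\<exists>x\<in>{1..n}. the ((\<alpha> \<otimes>\<^bsub>PT n\<^esub> \<beta>) x) \<noteq> x" using m True dom by (simp add: MDI_class_def)
    then obtain x where "x \<in> {1..n}" "the ((\<alpha> \<otimes>\<^bsub>PT n\<^esub> \<beta>) x) \<noteq> x" by blast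
    then show False using the_mult_PT[of x n \<alpha> \<beta>] id[of x] id'[of x] dom by simp
  next
    case False
    have unit: "restricts_unit n \<gamma> \<and> (i \<noteq> 1 \<longrightarrow> dom \<gamma> = {1..n})"
      if "\<gamma> \<in> carrier (MDI n)" "\<gamma> \<notin> MDI_class n i" "dom \<gamma> \<subseteq> {1..n}"
        "{1..n} - {i} \<subseteq> dom \<gamma> \<or> {1..n} - {n + 1 - i} \<subseteq> dom \<gamma>" for \<gamma>
    proof -
      have "dom \<gamma> = {1..n} \<or> dom \<gamma> = {1..n} - {i} \<or> dom \<gamma> = {1..n} - {n + 1 - i}"
        using that(4) subset_minus_point_cases[OF that(3)] by blast
      then show ?thesis
      proof
        assume "dom \<gamma> = {1..n}"
        then show ?thesis using MDI_restricts_unit[OF that(1) _ n] by blast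
      next
        assume "dom \<gamma> = {1..n} - {i} \<or> dom \<gamma> = {1..n} - {n + 1 - i}"
        then show ?thesis using that(2) False by (simp add: MDI_class_def)
      qed
    qed
    have d: "dom (\<alpha> \<otimes>\<^bsub>PT n\<^esub> \<beta>) = {1..n} - {i} \<or> dom (\<alpha> \<otimes>\<^bsub>PT n\<^esub> \<beta>) = {1..n} - {n + 1 - i}"
      using m False by (simp add: MDI_class_def)
    moreover have "dom (\<alpha> \<otimes>\<^bsub>PT n\<^esub> \<beta>) \<subseteq> dom \<alpha>" by (simp add: dom_mult_PT subset_iff)
    ultimately have ua: "restricts_unit n \<alpha> \<and> (i \<noteq> 1 \<longrightarrow> dom \<alpha> = {1..n})"
      using neg by (intro unit ab sub) blast+
    have "{1..n} - {i} \<subseteq> dom \<beta> \<or> {1..n} - {n + 1 - i} \<subseteq> dom \<beta>"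
    proof -
      have "n + 1 - (n + 1 - i) = i" "i \<in> {1..n}" "n + 1 - i \<in> {1..n}" using i False by auto
      then show ?thesis
        using d restricts_unit_dom_mult[OF a, of \<beta> i] restricts_unit_dom_mult[OF a, of \<beta> "n + 1 - i"] ua
        by argo
    qed
    then have ub: "restricts_unit n \<beta> \<and> (i \<noteq> 1 \<longrightarrow> dom \<beta> = {1..n})"
      using neg by (intro unit ab sub) blast+
    show False
    proof (cases "i = 1")
      case True
      then show False using restricts_unit_mult[OF a] ua ub m by (simp add: MDI_class_def)
    next
      case i1: False
      then have "dom \<alpha> = {1..n}" "dom \<beta> = {1..n}" using ua ub by simp_all
      then have "x \<in> dom (\<alpha> \<otimes>\<^bsub>PT n\<^esub> \<beta>)" if "x \<in> {1..n}" for x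
        using that DI_dest[OF a, of x] by (simp add: dom_mult_PT)
      moreover have "i \<in> {1..n}" "n + 1 - i \<in> {1..n}" using i False by auto
      ultimately show False using d by blast
    qed
  qed
qed

text \<open>The set of missing points is empty, {k} or {n + 1 - k}; the bound (n + 1) div 2 makes k
  the smaller of the two mirror points, so this set determines k.\<close>

lemma MDI_class_disjoint:
  assumes "\<alpha> \<in> MDI_class n i" "\<alpha> \<in> MDI_class n j" "i \<le> (n + 1) div 2" "j \<le> (n + 1) div 2"
  shows "i = j"
proof -
  have U: "{1..n} - ({1..n} - {k}) = {k}" if "k \<in> {1..n}" for k
    using that by blast
  define X where "X = {1..n} - dom \<alpha>"
  have X: "k = 0 \<and> X = {} \<or> k > 0 \<and> (X = {k} \<or> X = {n + 1 - k})"
    if "\<alpha> \<in> MDI_class n k" "k \<le> (n + 1) div 2" for k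
  proof (cases "k = 0")
    case True
    then show ?thesis using that(1) by (simp add: MDI_class_def X_def)
  next
    case False
    then have "k \<in> {1..n}" "n + 1 - k \<in> {1..n}" using that(2) by auto
    note U = U[OF this(1)] U[OF this(2)]
    have "dom \<alpha> = {1..n} - {k} \<or> dom \<alpha> = {1..n} - {n + 1 - k}"
      using that(1) False by (simp add: MDI_class_def)
    then have "X = {k} \<or> X = {n + 1 - k}" unfolding X_def using U by (elim disjE) simp_all
    then show ?thesis using False by simp
  qed
  from X[OF assms(1,3)] X[OF assms(2,4)] show ?thesis
    using assms(3,4) by (elim disjE conjE) simp_all
qed

theorem rank_MDI:
  assumes n: "n \<ge> 4"
  shows "monoid_rank (MDI n) = 2 + 3 * ((n - 1) div 2)"
proof -
  define D where "D = {d. 1 \<le> d \<and> d < n \<and> 2 * d \<noteq> n}"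
  have D: "finite D" "card D = 2 * ((n - 1) div 2)"
    using card_nonhalf_gaps[of n] n by (simp_all add: D_def)
  define I where "I = {0..(n + 1) div 2} <+> D"
  define G where "G = case_sum (MDI_gen n) (gap_gen n)"
  define F where "F = case_sum (MDI_class n) (gap_class n)"
  have G: "G i \<in> carrier (MDI n)" if "i \<in> I" for i
    using that MDI_gen_in_MDI subsetD[OF ODI_subset_MDI gap_gen_in_ODI] by (auto simp: I_def G_def D_def)
  have card_class: "card (dom a) \<ge> n - 1" if "a \<in> MDI_class n i" for a i
  proof -
    have "dom a = {1..n} \<or> dom a = {1..n} - {i} \<or> dom a = {1..n} - {n + 1 - i}"
      using that by (cases "i = 0") (simp_all add: MDI_class_def)
    moreover have "card ({1..n} - {k}) \<ge> n - 1" for k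
      using diff_card_le_card_Diff[of "{k}" "{1..n}"] by simp
    moreover have "card {1..n} \<ge> n - 1" by simp
    ultimately show ?thesis by metis
  qed
  have disj: "k = l" if a: "a \<in> F (Inl k)" "a \<in> F (Inl l)" "Inl k \<in> I" "Inl l \<in> I" for a k l
    using a(3,4) by (intro MDI_class_disjoint[OF a(1,2)[unfolded F_def sum.case]]) (auto simp: I_def)
  have disj': False
    if a: "a \<in> carrier (MDI n)" "a \<in> F (Inl k)" "a \<in> F (Inr d)" "Inl k \<in> I" "Inr d \<in> I" for a k d
  proof -
    have "card (dom a) \<ge> n - 1" using a(2) by (intro card_class[of a k]) (simp add: F_def)
    moreover have "card (dom a) \<le> 2"
      using a(1,3,5) by (intro card_dom_gap_class[of a n d]) (auto simp: F_def I_def D_def)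
    ultimately show False using n by simp
  qed
  have disj'': "d = e"
    if "a \<in> carrier (MDI n)" "a \<in> F (Inr d)" "a \<in> F (Inr e)" "Inr d \<in> I" "Inr e \<in> I" for a d e
    using that by (intro gap_class_disjoint[of a n]) (auto simp: F_def I_def D_def)
  have "monoid_rank (MDI n) = card I"
  proof (rule monoid_rank_eqI[where F = F and G = G])
    let ?S = "monoid_generate (MDI n) (G ` I)"
    have GI: "G ` I \<subseteq> carrier (DI n)" using G by (auto simp: MDI_iff)
    have S: "submonoid ?S (PT n)"
      by (rule generate_submonoid_PT) (use GI in simp_all)
    have sub: "G ` I \<subseteq> ?S"
      by (rule generate_submonoid_PT) (use GI in simp_all)
    interpret submonoid ?S "PT n" by (rule S)
    have gen: "MDI_gen n i \<in> ?S" if "i \<le> (n + 1) div 2" for i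
    proof -
      have "G (Inl i) \<in> G ` I" using that by (auto simp: I_def)
      then show ?thesis using sub by (auto simp: G_def)
    qed
    have h: "refl_perm n \<in> ?S" using gen[of 0] by (simp add: MDI_gen_def)
    \<comment> \<open>Here g is f conjugated by the reflection; it is prescribed through its values
      so that it can be stated in simplified form, such as x - 1 for \<open>Suc\<close>.\<close>
    have conj: "ptrans ({1..n} - {n + 1 - i}) g \<in> ?S"
      if "i \<in> {1..n}" "ptrans ({1..n} - {i}) f \<in> ?S"
        and g: "\<And>x. x \<in> {1..n} - {n + 1 - i} \<Longrightarrow> f (n + 1 - x) \<in> {1..n} \<and> n + 1 - f (n + 1 - x) = g x" for i f g
    proof -
      have "{x \<in> {1..n}. n + 1 - x \<in> {1..n} - {i}} = {1..n} - {n + 1 - i}" using that(1) by auto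
      then have "refl_perm n \<otimes>\<^bsub>PT n\<^esub> ptrans ({1..n} - {i}) f = ptrans ({1..n} - {n + 1 - i}) (\<lambda>x. f (n + 1 - x))"
        unfolding refl_perm_def mult_ptrans by simp
      moreover have "\<dots> \<otimes>\<^bsub>PT n\<^esub> refl_perm n = ptrans ({1..n} - {n + 1 - i}) g"
        unfolding refl_perm_def using g by (intro mult_ptrans_eq image_subsetI) blast+
      moreover have "refl_perm n \<otimes>\<^bsub>PT n\<^esub> ptrans ({1..n} - {i}) f \<otimes>\<^bsub>PT n\<^esub> refl_perm n \<in> ?S"
        by (intro m_closed h that)
      ultimately show ?thesis by simp
    qed
    have ODI: "carrier (ODI n) \<subseteq> ?S"
    proof (rule ODI_subset_submonoid[OF S])
      show up: "ptrans ({1..n} - {n}) Suc \<in> ?S"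
        using gen[of 1] n by (simp add: MDI_gen_def)
      have "ptrans ({1..n} - {n + 1 - n}) (\<lambda>x. x - 1) \<in> ?S"
        using n by (intro conj[OF _ up]) auto
      then show "ptrans ({1..n} - {1}) (\<lambda>x. x - 1) \<in> ?S" by simp
      show "ptrans ({1..n} - {i}) (\<lambda>x. x) \<in> ?S" if i: "1 < i" "i < n" for i
      proof (cases "i \<le> (n + 1) div 2")
        case True
        then show ?thesis using gen[of i] i by (simp add: MDI_gen_def)
      next
        case False
        then have "n + 1 - i \<le> (n + 1) div 2" by presburger
        moreover have "MDI_gen n (n + 1 - i) = ptrans ({1..n} - {n + 1 - i}) (\<lambda>x. x)"
          using i by (auto simp: MDI_gen_def)
        ultimately have "ptrans ({1..n} - {n + 1 - i}) (\<lambda>x. x) \<in> ?S"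
          using gen[of "n + 1 - i"] by simp
        then have "ptrans ({1..n} - {n + 1 - (n + 1 - i)}) (\<lambda>x. x) \<in> ?S"
          using i by (intro conj[of "n + 1 - i" "\<lambda>x. x"]) auto
        moreover have "n + 1 - (n + 1 - i) = i" using i by simp
        ultimately show ?thesis by simp
      qed
      show "gap_gen n d \<in> ?S" if "1 \<le> d" "d < n" "2 * d \<noteq> n" for d
      proof -
        have "G (Inr d) \<in> G ` I" using that by (auto simp: I_def D_def)
        then show ?thesis using sub by (auto simp: G_def)
      qed
    qed
    show "carrier (MDI n) \<subseteq> ?S"
    proof
      fix a assume a: "a \<in> carrier (MDI n)"
      then have aD: "a \<in> carrier (DI n)" by (simp add: MDI_iff)
      show "a \<in> ?S"
      proof (cases "a \<in> carrier (ODI n)")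
        case False
        then have "a \<otimes>\<^bsub>PT n\<^esub> refl_perm n \<in> ?S" using MDI_cases[OF a] ODI by blast
        moreover have "a \<otimes>\<^bsub>PT n\<^esub> refl_perm n \<otimes>\<^bsub>PT n\<^esub> refl_perm n = a"
        proof -
          interpret P: monoid "PT n" by (rule monoid_PT)
          have "refl_perm n \<otimes>\<^bsub>PT n\<^esub> refl_perm n = \<one>\<^bsub>PT n\<^esub>"
            unfolding refl_perm_def one_PT_eq by (intro mult_ptrans_eq) auto
          moreover have "a \<in> carrier (PT n)" using aD by (simp add: DI_def)
          moreover have "refl_perm n \<in> carrier (PT n)" using h subset by blast
          ultimately show ?thesis by (simp add: P.m_assoc)
        qed
        ultimately show ?thesis using h m_closed by metis
      qed (use ODI in blast)
    qed
    show "G i \<in> F i" if "i \<in> I" for i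
      using that n MDI_gen_in_class gap_gen_in_gap_class by (auto simp: I_def G_def F_def D_def)
    show "\<one>\<^bsub>MDI n\<^esub> \<notin> F i" if "i \<in> I" for i
      using that n one_notin_gap_class one_notin_MDI_class by (auto simp: I_def F_def D_def)
    show "a \<in> F i \<or> b \<in> F i"
      if "i \<in> I" "a \<in> carrier (MDI n)" "b \<in> carrier (MDI n)" "a \<otimes>\<^bsub>MDI n\<^esub> b \<in> F i" for i a b
    proof (cases i)
      case (Inl k)
      then show ?thesis using MDI_class_prime[of n a b k] that n by (auto simp: F_def I_def)
    next
      case (Inr d)
      then show ?thesis using gap_class_prime[of a n b d] that by (simp add: F_def MDI_iff)
    qed
    show "i = j" if "i \<in> I" "j \<in> I" "a \<in> carrier (MDI n)" "a \<in> F i" "a \<in> F j" for i j a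
      using that by (cases i; cases j; simp; blast dest: disj disj' disj'')
  qed (use D G monoids in \<open>auto simp: I_def\<close>)
  also have "card I = 2 + 3 * ((n - 1) div 2)"
  proof -
    \<comment> \<open>The indices \<open>0..(n + 1) div 2\<close> contribute
      \<open>(n - 1) div 2 + 2\<close> classes, the gaps \<open>2 * ((n - 1) div 2)\<close>.\<close>
    have "(n + 1) div 2 = (n - 1) div 2 + 1" using n by presburger
    then show ?thesis using D by (simp add: I_def card_Plus)
  qed
  finally show ?thesis .
qed

section \<open>Orientation-preserving partial isometries\<close>

text \<open>Addition modulo n with representatives 1 to n. Both \<open>k = 0\<close> and
  \<open>k = n\<close> act as the identity on \<open>{1..n}\<close>, so n + 1 - x is a legal angle
  for every x.\<close>

definition rot :: "nat \<Rightarrow> nat \<Rightarrow> nat \<Rightarrow> nat" where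
  "rot n k x = (if x + k \<le> n then x + k else x + k - n)"

lemma rot_in_range: "k \<le> n \<Longrightarrow> x \<in> {1..n} \<Longrightarrow> rot n k x \<in> {1..n}"
  by (auto simp: rot_def)

lemma ptrans_rot_in_OPDI:
  assumes "A \<subseteq> {1..n}" "k \<le> n"
  shows "ptrans A (rot n k) \<in> carrier (OPDI n)"
proof -
  have r: "1 \<le> x \<and> x \<le> n" if "x \<in> A" for x using that assms(1) by auto
  have "\<bar>int (rot n k x) - int (rot n k y)\<bar> = \<bar>int x - int y\<bar> \<or>
        \<bar>int (rot n k x) - int (rot n k y)\<bar> = int n - \<bar>int x - int y\<bar>" if "x \<in> A" "y \<in> A" for x y
    using r[OF that(1)] r[OF that(2)] assms(2) unfolding rot_def by (auto simp: of_nat_diff)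
  moreover have "cyc3 (rot n k x) (rot n k y) (rot n k z)" if "x \<in> A" "y \<in> A" "z \<in> A" "cyc3 x y z" for x y z
    using that(4) r[OF that(1)] r[OF that(2)] r[OF that(3)] assms(2) unfolding rot_def cyc3_def
    by (elim disjE) (simp_all split: if_split, linarith+)
  ultimately show ?thesis
    using assms rot_in_range[OF assms(2)] unfolding OPDI_iff DI_iff by (auto simp: subset_iff)
qed

lemma OPDI_gap:
  assumes "\<alpha> \<in> carrier (OPDI n)" "x \<in> dom \<alpha>" "y \<in> dom \<alpha>" "z \<in> dom \<alpha>" "z \<noteq> x" "z \<noteq> y"
  shows "int (the (\<alpha> y)) - int (the (\<alpha> x)) \<in> {int y - int x, int y - int x - int n, int y - int x + int n}"
proof -
  have *: "int (the (\<alpha> y)) - int (the (\<alpha> x)) = int y - int x \<or>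
      int (the (\<alpha> y)) - int (the (\<alpha> x)) = int y - int x - int n"
    if h: "x < y" "x \<in> dom \<alpha>" "y \<in> dom \<alpha>" "z \<noteq> x" "z \<noteq> y" for x y
  proof -
    consider "z < x" | "x < z" "z < y" | "y < z" using h(4,5) by linarith
    then show ?thesis
    proof cases
      case 1
      then show ?thesis using OPDI_gap_lt[OF assms(1,4) h(2,3)] h(1) by simp
    next
      case 2
      then show ?thesis using OPDI_gap_lt[OF assms(1) h(2) assms(4) h(3)] by simp
    next
      case 3
      then show ?thesis using OPDI_gap_lt[OF assms(1) h(2,3) assms(4)] h(1) by simp
    qed
  qed
  consider "x < y" | "x = y" | "y < x" by linarith
  then show ?thesis
  proof cases
    case 3
    then show ?thesis using *[of y x] assms by auto
  qed (use *[of x y] assms in auto)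
qed

text \<open>A pair whose step is not kept modulo n admits no third point by rigidity, and an
  isometry can then only negate the step.\<close>

lemma OPDI_cases:
  assumes "\<alpha> \<in> carrier (OPDI n)"
  obtains (rot) k where "k \<le> n" "\<And>x. x \<in> dom \<alpha> \<Longrightarrow> the (\<alpha> x) = rot n k x"
  | (swap) x y d where "dom \<alpha> = {x, y}" "1 \<le> d" "2 * d < n"
      "int y - int x = int d \<or> int y - int x = int d - int n"
      "int (the (\<alpha> y)) - int (the (\<alpha> x)) = - int d \<or> int (the (\<alpha> y)) - int (the (\<alpha> x)) = int n - int d"
proof (cases "\<forall>x\<in>dom \<alpha>. \<forall>y\<in>dom \<alpha>. int (the (\<alpha> y)) - int (the (\<alpha> x)) \<in>
    {int y - int x, int y - int x - int n, int y - int x + int n}")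
  case True
  have a: "\<alpha> \<in> carrier (DI n)" using assms by (simp add: OPDI_iff)
  show ?thesis
  proof (cases "dom \<alpha> = {}")
    case True
    then show ?thesis by (intro rot[of 0]) auto
  next
    case False
    then obtain z where z: "z \<in> dom \<alpha>" by blast
    define k where "k = (if z \<le> the (\<alpha> z) then the (\<alpha> z) - z else the (\<alpha> z) + n - z)"
    note bz = DI_dest[OF a z]
    have "k \<le> n" using bz by (auto simp: k_def)
    moreover have "the (\<alpha> x) = rot n k x" if x: "x \<in> dom \<alpha>" for x
      using True[rule_format, OF z x] bz DI_dest[OF a x] unfolding rot_def k_def
      by (auto split: if_splits)
    ultimately show ?thesis by (rule rot)
  qed
next
  case False
  then obtain x y where xy: "x \<in> dom \<alpha>" "y \<in> dom \<alpha>" "int (the (\<alpha> y)) - int (the (\<alpha> x)) \<notin>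
    {int y - int x, int y - int x - int n, int y - int x + int n}" by blast
  have a: "\<alpha> \<in> carrier (DI n)" using assms by (simp add: OPDI_iff)
  define i j where "i = min x y" and "j = max x y"
  have ij: "i \<in> dom \<alpha>" "j \<in> dom \<alpha>" "i < j" "int (the (\<alpha> j)) - int (the (\<alpha> i)) \<notin>
    {int j - int i, int j - int i - int n, int j - int i + int n}"
    using xy by (cases x y rule: linorder_cases; auto simp: i_def j_def)+
  have "dom \<alpha> = {i, j}"
    using OPDI_gap[OF assms ij(1,2)] ij(1,2,4) by blast
  moreover have *: "int (the (\<alpha> j)) - int (the (\<alpha> i)) = - (int j - int i) \<or>
      int (the (\<alpha> j)) - int (the (\<alpha> i)) = int n - (int j - int i)"
    using DI_dist[OF a ij(1,2)] ij(3,4) by (auto simp: abs_if split: if_splits)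
  \<comment> \<open>A step of n/2 equals its negative modulo n and would have been kept.\<close>
  moreover have "2 * (int j - int i) \<noteq> int n" using * ij(4) by auto
  moreover have "1 \<le> i" "j \<le> n" using DI_dest[OF a] ij by auto
  ultimately show ?thesis
    \<comment> \<open>The pair is read in the direction of its shorter arc: j - i starting from i,
      or n - (j - i) starting from j.\<close>
    using ij(3) swap[of i j "j - i"] swap[of j i "n - (j - i)"]
    by (cases "2 * (j - i) < n") (auto simp: of_nat_diff insert_commute)
qed

section \<open>Swaps of a pair at a fixed cyclic distance\<close>

definition swap_gen :: "nat \<Rightarrow> nat \<Rightarrow> nat \<rightharpoonup> nat" where
  "swap_gen n d = ptrans {1, 1 + d} (\<lambda>x. if x = 1 then 1 + d else 1)"

text \<open>The pair has step d modulo n and its image has step -d, each written with its two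
  representatives strictly between -n and n. Directed steps are needed because a rotation can turn
  |x - y| = d into n - d without swapping anything.\<close>

definition swap_class :: "nat \<Rightarrow> nat \<Rightarrow> (nat \<rightharpoonup> nat) set" where
  "swap_class n d = {\<alpha>. \<exists>x\<in>dom \<alpha>. \<exists>y\<in>dom \<alpha>.
     (int y - int x = int d \<or> int y - int x = int d - int n) \<and>
     (int (the (\<alpha> y)) - int (the (\<alpha> x)) = - int d \<or> int (the (\<alpha> y)) - int (the (\<alpha> x)) = int n - int d)}"

lemma swap_gen_in_OPDI: "d < n \<Longrightarrow> swap_gen n d \<in> carrier (OPDI n)"
  unfolding OPDI_iff DI_iff swap_gen_def dom_ptrans by (auto simp: cyc3_def)

lemma swap_gen_in_swap_class: "0 < d \<Longrightarrow> swap_gen n d \<in> swap_class n d"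
  unfolding swap_class_def swap_gen_def
  by (auto intro!: bexI[of _ 1] bexI[of _ "1 + d"])

lemma one_notin_swap_class: "0 < d \<Longrightarrow> 2 * d < n \<Longrightarrow> \<one>\<^bsub>PT n\<^esub> \<notin> swap_class n d"
  unfolding one_PT_eq swap_class_def by auto

text \<open>The first factor maps a step d to d or to -d modulo n. In the second case it lies in the
  class itself; in the first, \<beta> must negate the step.\<close>

lemma swap_class_prime:
  assumes "\<alpha> \<in> carrier (DI n)" "\<beta> \<in> carrier (DI n)" "\<alpha> \<otimes>\<^bsub>PT n\<^esub> \<beta> \<in> swap_class n d" "0 < d" "2 * d < n"
  shows "\<alpha> \<in> swap_class n d \<or> \<beta> \<in> swap_class n d"
proof -
  obtain x y where xy: "x \<in> dom (\<alpha> \<otimes>\<^bsub>PT n\<^esub> \<beta>)" "y \<in> dom (\<alpha> \<otimes>\<^bsub>PT n\<^esub> \<beta>)"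
    "int y - int x = int d \<or> int y - int x = int d - int n"
    "int (the (\<beta> (the (\<alpha> y)))) - int (the (\<beta> (the (\<alpha> x)))) = - int d \<or>
     int (the (\<beta> (the (\<alpha> y)))) - int (the (\<beta> (the (\<alpha> x)))) = int n - int d"
    using assms(3) by (auto simp: swap_class_def the_mult_PT)
  have d: "x \<in> dom \<alpha>" "y \<in> dom \<alpha>" "the (\<alpha> x) \<in> dom \<beta>" "the (\<alpha> y) \<in> dom \<beta>"
    using xy by (auto simp: dom_mult_PT)
  have "\<bar>int x - int y\<bar> = int d \<or> \<bar>int x - int y\<bar> = int n - int d"
    using xy(3) assms(4,5) by linarith
  then have "\<bar>int (the (\<alpha> x)) - int (the (\<alpha> y))\<bar> = int d \<or>
      \<bar>int (the (\<alpha> x)) - int (the (\<alpha> y))\<bar> = int n - int d"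
    using DI_dist[OF assms(1) d(1,2)] by linarith
  then have "int (the (\<alpha> y)) - int (the (\<alpha> x)) \<in> {int d, int d - int n, - int d, int n - int d}"
    by (auto simp: abs_if split: if_splits)
  then show ?thesis using xy d unfolding swap_class_def by blast
qed

lemma swap_class_OPDI:
  assumes "\<alpha> \<in> carrier (OPDI n)" "\<alpha> \<in> swap_class n d" "0 < d" "2 * d < n"
  obtains x y where "dom \<alpha> = {x, y}" "int y - int x = int d \<or> int y - int x = int d - int n"
proof -
  obtain x y where xy: "x \<in> dom \<alpha>" "y \<in> dom \<alpha>"
    "int y - int x = int d \<or> int y - int x = int d - int n"
    "int (the (\<alpha> y)) - int (the (\<alpha> x)) = - int d \<or> int (the (\<alpha> y)) - int (the (\<alpha> x)) = int n - int d"
    using assms(2) by (auto simp: swap_class_def)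
  have "z = x \<or> z = y" if "z \<in> dom \<alpha>" for z
  proof (rule ccontr)
    assume "\<not> (z = x \<or> z = y)"
    then have "int (the (\<alpha> y)) - int (the (\<alpha> x)) \<in> {int y - int x, int y - int x - int n, int y - int x + int n}"
      by (intro OPDI_gap[OF assms(1) xy(1,2) that]) auto
    then show False
      using xy(3,4) assms(3,4) unfolding insert_iff empty_iff by linarith
  qed
  then show ?thesis using xy by (intro that[of x y]) auto
qed

text \<open>The domain is the pair alone; its two directions have steps d and n - d, and only one of
  these is below n/2.\<close>

lemma swap_class_disjoint:
  assumes "\<alpha> \<in> carrier (OPDI n)" "\<alpha> \<in> swap_class n d" "\<alpha> \<in> swap_class n d'"
    "0 < d" "2 * d < n" "0 < d'" "2 * d' < n"
  shows "d = d'"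
proof -
  obtain x y where xy: "dom \<alpha> = {x, y}" "int y - int x = int d \<or> int y - int x = int d - int n"
    by (rule swap_class_OPDI[OF assms(1,2,4,5)])
  obtain x' y' where xy': "dom \<alpha> = {x', y'}" "int y' - int x' = int d' \<or> int y' - int x' = int d' - int n"
    by (rule swap_class_OPDI[OF assms(1,3,6,7)])
  have "x = x' \<and> y = y' \<or> x = y' \<and> y = x'" using xy(1) xy'(1) by (auto simp: doubleton_eq_iff)
  then show ?thesis using xy(2) xy'(2) assms(4-7) by auto
qed

lemma card_dom_swap_class:
  assumes "\<alpha> \<in> carrier (OPDI n)" "\<alpha> \<in> swap_class n d" "0 < d" "2 * d < n"
  shows "card (dom \<alpha>) \<le> 2"
proof -
  obtain x y where "dom \<alpha> = {x, y}" by (rule swap_class_OPDI[OF assms])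
  then show ?thesis by (simp add: card_insert_le_m1)
qed

section \<open>The rank of the monoid of orientation-preserving partial isometries\<close>

lemma OPDI_subset_submonoid:
  assumes "submonoid S (PT n)" and n: "n \<ge> 1"
    and rot: "ptrans {1..n} (rot n 1) \<in> S" and idem: "ptrans ({1..n} - {1}) (\<lambda>x. x) \<in> S"
    and swap_gens: "\<And>d. 1 \<le> d \<Longrightarrow> 2 * d < n \<Longrightarrow> swap_gen n d \<in> S"
  shows "carrier (OPDI n) \<subseteq> S"
proof
  interpret submonoid S "PT n" by fact
  have rots: "ptrans {1..n} (rot n k) \<in> S" if "k \<le> n" for k
    using that
  proof (induction k)
    case 0
    have "ptrans {1..n} (rot n 0) = \<one>\<^bsub>PT n\<^esub>"
      by (rule sym, rule eq_ptransI) (auto simp: dom_one_PT the_one_PT rot_def)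
    then show ?case using one_closed by simp
  next
    case (Suc k)
    have "rot n k ` {1..n} \<subseteq> {1..n}"
      using Suc.prems rot_in_range by (intro image_subsetI) simp
    moreover have "rot n 1 (rot n k x) = rot n (Suc k) x" if "x \<in> {1..n}" for x
      using Suc.prems that by (auto simp: rot_def)
    ultimately have "ptrans {1..n} (rot n k) \<otimes>\<^bsub>PT n\<^esub> ptrans {1..n} (rot n 1) = ptrans {1..n} (rot n (Suc k))"
      by (rule mult_ptrans_eq)
    moreover have "ptrans {1..n} (rot n k) \<in> S" using Suc by simp
    ultimately show ?case using m_closed[OF _ rot, of "ptrans {1..n} (rot n k)"] by simp
  qed
  have "ptrans ({1..n} - {i}) (\<lambda>x. x) \<in> S" if i: "i \<in> {1..n}" for i
  proof -
    \<comment> \<open>Rotation by n + 1 - i takes i to 1, and rotation by i - 1 undoes it;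
      conjugation thus moves the omitted point from 1 to i.\<close>
    have "rot n (n + 1 - i) x \<in> {1..n} - {1} \<longleftrightarrow> x \<noteq> i" if "x \<in> {1..n}" for x
      using that i by (auto simp: rot_def)
    then have "{x \<in> {1..n}. rot n (n + 1 - i) x \<in> {1..n} - {1}} = {1..n} - {i}" by blast
    then have 1: "ptrans {1..n} (rot n (n + 1 - i)) \<otimes>\<^bsub>PT n\<^esub> ptrans ({1..n} - {1}) (\<lambda>x. x)
        = ptrans ({1..n} - {i}) (rot n (n + 1 - i))"
      unfolding mult_ptrans by simp
    have "n + 1 - i \<le> n" using i by auto
    then have "rot n (n + 1 - i) ` ({1..n} - {i}) \<subseteq> {1..n}"
      using rot_in_range by blast
    moreover have "rot n (i - 1) (rot n (n + 1 - i) x) = x" if "x \<in> {1..n} - {i}" for x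
      using that i by (auto simp: rot_def)
    ultimately have "ptrans ({1..n} - {i}) (rot n (n + 1 - i)) \<otimes>\<^bsub>PT n\<^esub> ptrans {1..n} (rot n (i - 1))
        = ptrans ({1..n} - {i}) (\<lambda>x. x)"
      by (rule mult_ptrans_eq)
    moreover have "ptrans {1..n} (rot n (n + 1 - i)) \<otimes>\<^bsub>PT n\<^esub> ptrans ({1..n} - {1}) (\<lambda>x. x)
        \<otimes>\<^bsub>PT n\<^esub> ptrans {1..n} (rot n (i - 1)) \<in> S"
      using i by (intro m_closed rots idem) auto
    ultimately show ?thesis by (simp only: 1)
  qed
  note ids = partial_identity_in_submonoid[OF assms(1) this]
  have partial_rots: "ptrans A (rot n k) \<in> S" if "A \<subseteq> {1..n}" "k \<le> n" for A k
  proof -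
    have "ptrans A (\<lambda>x. x) \<otimes>\<^bsub>PT n\<^esub> ptrans {1..n} (rot n k) = ptrans A (rot n k)"
      using that(1) by (intro mult_ptrans_eq) auto
    moreover have "ptrans A (\<lambda>x. x) \<otimes>\<^bsub>PT n\<^esub> ptrans {1..n} (rot n k) \<in> S"
      by (intro m_closed ids rots that)
    ultimately show ?thesis by simp
  qed
  fix \<alpha> assume \<alpha>: "\<alpha> \<in> carrier (OPDI n)"
  then have a: "\<alpha> \<in> carrier (DI n)" by (simp add: OPDI_iff)
  then have dom: "dom \<alpha> \<subseteq> {1..n}" by (simp add: DI_iff)
  from \<alpha> show "\<alpha> \<in> S"
  proof (cases rule: OPDI_cases)
    case (rot k)
    have "\<alpha> = ptrans (dom \<alpha>) (rot n k)" using rot(2) by (intro eq_ptransI) auto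
    then show ?thesis using partial_rots[OF dom rot(1)] by simp
  next
    case (swap x y d)
    have xy: "x \<in> dom \<alpha>" "y \<in> dom \<alpha>" using swap(1) by auto
    note b = DI_dest[OF a xy(1)] DI_dest[OF a xy(2)]
    \<comment> \<open>Rotation by k takes x to 1 and hence y to 1 + d; after the swap, rotation by l
      takes 1 + d to the image of x and hence 1 to the image of y.\<close>
    define k where "k = n + 1 - x"
    define l where "l = (if 1 + d \<le> the (\<alpha> x) then the (\<alpha> x) - (1 + d) else the (\<alpha> x) + n - (1 + d))"
    have kl: "k \<le> n" "l \<le> n" using b swap(2,3) by (auto simp: k_def l_def)
    have k: "rot n k x = 1" "rot n k y = 1 + d"
      using b swap(2-4) by (auto simp: rot_def k_def)
    have l: "rot n l (1 + d) = the (\<alpha> x)" "rot n l 1 = the (\<alpha> y)"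
      using b swap(2,3,5) by (auto simp: rot_def l_def)
    have "ptrans {x, y} (rot n k) \<otimes>\<^bsub>PT n\<^esub> swap_gen n d = ptrans {x, y} (\<lambda>u. if u = x then 1 + d else 1)"
      unfolding swap_gen_def using k swap(2) by (intro mult_ptrans_eq) auto
    moreover have "\<dots> \<otimes>\<^bsub>PT n\<^esub> ptrans {1, 1 + d} (rot n l) = ptrans {x, y} (\<lambda>u. the (\<alpha> u))"
      using l swap(2) k by (intro mult_ptrans_eq) auto
    moreover have "\<dots> = \<alpha>"
      using swap(1) by (intro eq_ptransI[symmetric]) auto
    moreover have "ptrans {x, y} (rot n k) \<otimes>\<^bsub>PT n\<^esub> swap_gen n d \<otimes>\<^bsub>PT n\<^esub> ptrans {1, 1 + d} (rot n l) \<in> S"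
      using b swap(2,3) kl by (intro m_closed partial_rots swap_gens) auto
    ultimately show ?thesis by simp
  qed
qed

section \<open>Units and maps of rank n - 1 among the orientation-preserving maps\<close>

definition OPDI_gen :: "nat \<Rightarrow> bool \<Rightarrow> nat \<rightharpoonup> nat" where
  "OPDI_gen n u = (if u then ptrans {1..n} (rot n 1) else ptrans ({1..n} - {1}) (\<lambda>x. x))"

text \<open>In rank n - 1 the omitted point is not recorded, since rotations carry any point to any
  other.\<close>

definition OPDI_class :: "nat \<Rightarrow> bool \<Rightarrow> (nat \<rightharpoonup> nat) set" where
  "OPDI_class n u = {\<alpha>. if u then dom \<alpha> = {1..n} \<and> \<alpha> \<noteq> \<one>\<^bsub>PT n\<^esub> else card (dom \<alpha>) = n - 1}"

lemma OPDI_gen_in_OPDI: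
  assumes "n \<ge> 1"
  shows "OPDI_gen n u \<in> carrier (OPDI n)"
proof (cases u)
  case True
  then show ?thesis using ptrans_rot_in_OPDI[of "{1..n}" n 1] assms by (simp add: OPDI_gen_def)
next
  case False
  have "ptrans ({1..n} - {1}) (rot n 0) = ptrans ({1..n} - {1}) (\<lambda>x. x)"
    by (rule eq_ptransI) (auto simp: rot_def)
  then show ?thesis using ptrans_rot_in_OPDI[of "{1..n} - {1}" n 0] False by (auto simp: OPDI_gen_def)
qed

lemma OPDI_gen_in_class:
  assumes "n \<ge> 2"
  shows "OPDI_gen n u \<in> OPDI_class n u"
proof -
  have "the (ptrans {1..n} (rot n 1) 1) \<noteq> the (\<one>\<^bsub>PT n\<^esub> 1)"
    using assms by (simp add: rot_def the_one_PT)
  then have "ptrans {1..n} (rot n 1) \<noteq> \<one>\<^bsub>PT n\<^esub>" by metis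
  then show ?thesis using assms by (cases u) (simp_all add: OPDI_gen_def OPDI_class_def)
qed

lemma one_notin_OPDI_class: "n \<ge> 1 \<Longrightarrow> \<one>\<^bsub>PT n\<^esub> \<notin> OPDI_class n u"
  by (cases u) (simp_all add: OPDI_class_def dom_one_PT)

text \<open>A total \<alpha> is a permutation. If the product is a nonidentity permutation, \<alpha>
  is one too or else is the identity and the product is \<beta>. If the product has rank n - 1, then
  \<alpha> has that rank or is a permutation, and in the latter case \<beta> has the rank of the
  product.\<close>

lemma OPDI_class_prime:
  assumes ab: "\<alpha> \<in> carrier (DI n)" "\<beta> \<in> carrier (DI n)"
    and m: "\<alpha> \<otimes>\<^bsub>PT n\<^esub> \<beta> \<in> OPDI_class n u"
  shows "\<alpha> \<in> OPDI_class n u \<or> \<beta> \<in> OPDI_class n u"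
proof -
  have sub: "dom \<alpha> \<subseteq> {1..n}" "dom \<beta> \<subseteq> {1..n}" "(\<lambda>x. the (\<alpha> x)) ` dom \<alpha> \<subseteq> {1..n}"
    using ab by (auto simp: DI_iff)
  have dm: "dom (\<alpha> \<otimes>\<^bsub>PT n\<^esub> \<beta>) = {x \<in> dom \<alpha>. the (\<alpha> x) \<in> dom \<beta>}"
    by (auto simp: dom_mult_PT)
  note inj = inj_on_DI[OF ab(1)]
  have perm: "(\<lambda>x. the (\<alpha> x)) ` {1..n} = {1..n}" if "dom \<alpha> = {1..n}"
    using endo_inj_surj[of "{1..n}"] sub(3) inj that by simp
  show ?thesis
  proof (cases u)
    case True
    then have d: "dom (\<alpha> \<otimes>\<^bsub>PT n\<^esub> \<beta>) = {1..n}" and ne: "\<alpha> \<otimes>\<^bsub>PT n\<^esub> \<beta> \<noteq> \<one>\<^bsub>PT n\<^esub>"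
      using m by (simp_all add: OPDI_class_def)
    have "{1..n} \<subseteq> dom \<alpha>" unfolding d[symmetric] dm by blast
    then have da: "dom \<alpha> = {1..n}" using sub(1) by (rule antisym[rotated])
    show ?thesis
    proof (cases "\<alpha> = \<one>\<^bsub>PT n\<^esub>")
      case True
      interpret monoid "PT n" by (rule monoid_PT)
      have "\<beta> \<in> carrier (PT n)" using ab(2) by (simp add: DI_def)
      then show ?thesis using True m by simp
    qed (use True da in \<open>simp add: OPDI_class_def\<close>)
  next
    case False
    then have c: "card (dom (\<alpha> \<otimes>\<^bsub>PT n\<^esub> \<beta>)) = n - 1" using m by (simp add: OPDI_class_def)
    have "card (dom \<alpha>) \<le> n" using card_mono[OF _ sub(1)] by simp
    moreover have "n - 1 \<le> card (dom \<alpha>)"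
      unfolding c[symmetric] by (intro card_mono finite_dom_DI[OF ab(1)]) (auto simp: dm)
    ultimately consider "card (dom \<alpha>) = n - 1" | "card (dom \<alpha>) = n" by linarith
    then show ?thesis
    proof cases
      case 1
      then show ?thesis using False by (simp add: OPDI_class_def)
    next
      case 2
      then have da: "dom \<alpha> = {1..n}" using card_subset_eq[OF _ sub(1)] by simp
      have "(\<lambda>x. the (\<alpha> x)) ` dom (\<alpha> \<otimes>\<^bsub>PT n\<^esub> \<beta>) = dom \<beta>"
      proof -
        have "(\<lambda>x. the (\<alpha> x)) ` dom (\<alpha> \<otimes>\<^bsub>PT n\<^esub> \<beta>) = (\<lambda>x. the (\<alpha> x)) ` dom \<alpha> \<inter> dom \<beta>"
          unfolding dm by blast
        also have "\<dots> = {1..n} \<inter> dom \<beta>" using perm[OF da] da by simp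
        finally show ?thesis using sub(2) by (simp add: Int_absorb1)
      qed
      moreover have "inj_on (\<lambda>x. the (\<alpha> x)) (dom (\<alpha> \<otimes>\<^bsub>PT n\<^esub> \<beta>))"
        by (rule inj_on_subset[OF inj]) (auto simp: dm)
      ultimately have "card (dom \<beta>) = n - 1" using c card_image by metis
      then show ?thesis using False by (simp add: OPDI_class_def)
    qed
  qed
qed

theorem rank_OPDI:
  assumes n: "n \<ge> 4"
  shows "monoid_rank (OPDI n) = 2 + (n - 1) div 2"
proof -
  define I :: "(bool + nat) set" where "I = UNIV <+> {1..(n - 1) div 2}"
  have IR: "0 < d" "2 * d < n" if "Inr d \<in> I" for d
    using that n by (auto simp: I_def)
  define G where "G = case_sum (OPDI_gen n) (swap_gen n)"
  define F where "F = case_sum (OPDI_class n) (swap_class n)"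
  have G: "G i \<in> carrier (OPDI n)" if "i \<in> I" for i
  proof (cases i)
    case (Inl u)
    then show ?thesis using OPDI_gen_in_OPDI n by (simp add: G_def)
  next
    case (Inr d)
    then show ?thesis using swap_gen_in_OPDI IR[of d] that by (simp add: G_def)
  qed
  have disj: "k = l" if "a \<in> F (Inl k)" "a \<in> F (Inl l)" for a k l
    using that n by (cases k; cases l) (simp_all add: F_def OPDI_class_def)
  have disj': False
    if a: "a \<in> carrier (OPDI n)" "a \<in> F (Inl k)" "a \<in> F (Inr d)" "Inr d \<in> I" for a k d
  proof -
    have "card (dom a) \<ge> n - 1" using a(2) by (cases k) (simp_all add: F_def OPDI_class_def)
    moreover have "card (dom a) \<le> 2"
      using a(1,3) IR[OF a(4)] by (intro card_dom_swap_class[of a n d]) (simp_all add: F_def)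
    ultimately show False using n by simp
  qed
  have disj'': "d = e"
    if "a \<in> carrier (OPDI n)" "a \<in> F (Inr d)" "a \<in> F (Inr e)" "Inr d \<in> I" "Inr e \<in> I" for a d e
    using that(1-3) IR[OF that(4)] IR[OF that(5)] by (intro swap_class_disjoint[of a n]) (simp_all add: F_def)
  have "monoid_rank (OPDI n) = card I"
  proof (rule monoid_rank_eqI[where F = F and G = G])
    let ?S = "monoid_generate (OPDI n) (G ` I)"
    have GI: "G ` I \<subseteq> carrier (DI n)" using G by (auto simp: OPDI_iff)
    have sub: "G ` I \<subseteq> ?S"
      by (rule generate_submonoid_PT) (use GI in simp_all)
    have gen: "OPDI_gen n u \<in> ?S" for u
    proof -
      have "G (Inl u) \<in> G ` I" by (auto simp: I_def)
      then show ?thesis using sub by (auto simp: G_def)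
    qed
    show "carrier (OPDI n) \<subseteq> ?S"
    proof (rule OPDI_subset_submonoid)
      show "submonoid ?S (PT n)"
        by (rule generate_submonoid_PT) (use GI in simp_all)
      show "ptrans {1..n} (rot n 1) \<in> ?S" using gen[of True] by (simp add: OPDI_gen_def)
      show "ptrans ({1..n} - {1}) (\<lambda>x. x) \<in> ?S" using gen[of False] by (simp add: OPDI_gen_def)
      show "swap_gen n d \<in> ?S" if "1 \<le> d" "2 * d < n" for d
      proof -
        have "Inr d \<in> I" using that by (auto simp: I_def)
        then have "G (Inr d) \<in> G ` I" by (rule imageI)
        then show ?thesis using sub by (auto simp: G_def)
      qed
    qed (use n in simp)
    show "G i \<in> F i" if "i \<in> I" for i
    proof (cases i)
      case (Inl u)
      then show ?thesis using OPDI_gen_in_class n by (simp add: G_def F_def)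
    next
      case (Inr d)
      then show ?thesis using swap_gen_in_swap_class IR[of d] that by (simp add: G_def F_def)
    qed
    show "\<one>\<^bsub>OPDI n\<^esub> \<notin> F i" if "i \<in> I" for i
    proof (cases i)
      case (Inl u)
      then show ?thesis using one_notin_OPDI_class n by (simp add: F_def)
    next
      case (Inr d)
      then show ?thesis using one_notin_swap_class IR[of d] that by (simp add: F_def)
    qed
    show "a \<in> F i \<or> b \<in> F i"
      if "i \<in> I" "a \<in> carrier (OPDI n)" "b \<in> carrier (OPDI n)" "a \<otimes>\<^bsub>OPDI n\<^esub> b \<in> F i" for i a b
    proof (cases i)
      case (Inl k)
      then show ?thesis using OPDI_class_prime[of a n b k] that by (simp add: F_def OPDI_iff)
    next
      case (Inr d)
      then show ?thesis using swap_class_prime[of a n b d] IR[of d] that by (simp add: F_def OPDI_iff)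
    qed
    show "i = j" if "i \<in> I" "j \<in> I" "a \<in> carrier (OPDI n)" "a \<in> F i" "a \<in> F j" for i j a
    proof (cases i; cases j)
      fix k l assume "i = Inl k" "j = Inl l"
      then show ?thesis using disj[of a k l] that by simp
    next
      fix k d assume "i = Inl k" "j = Inr d"
      then show ?thesis using disj'[of a k d] that by simp
    next
      fix d k assume "i = Inr d" "j = Inl k"
      then show ?thesis using disj'[of a k d] that by simp
    next
      fix d e assume "i = Inr d" "j = Inr e"
      then show ?thesis using disj''[of a d e] that by simp
    qed
  qed (use G monoids in \<open>auto simp: I_def\<close>)
  also have "card I = 2 + (n - 1) div 2"
    by (simp add: I_def card_Plus)
  finally show ?thesis .
qed

theorem theorem4p3:
  fixes n :: nat
  assumes "n \<ge> 4"
  shows "monoid_rank (ODI n) = n + 2 * ((n - 1) div 2) \<and>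
         monoid_rank (MDI n) = 2 + 3 * ((n - 1) div 2) \<and>
         monoid_rank (OPDI n) = 2 + (n - 1) div 2"
  using rank_ODI rank_MDI rank_OPDI assms by blast

end
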